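(* Let $n\ge 2$ and let $\Pi_0,\dots,\Pi_n\subset\mathbb{P}^n$ be general linear subspaces of codimension $2$, with coordinates $x_0,\dots,x_n$ and forms $Q_0,\dots,Q_n$ as in the context. The polynomials $x_iQ_i$, $i=0,\dots,n$, form a basis of $\mathcal{L}_n$. Hence $\dim\mathcal{L}_n=n+1$ (as a vector space), so $v_n$ is a rational map to $\mathbb{P}^n$ whose image is not contained in a hyperplane.
   Context: $\mathbb{P}^n$ is projective space over a ground field $K$ of characteristic $0$; points and lines are understood geometrically (i.e. over an algebraic closure if $K$ is not algebraically closed). "General" means: for all choices in some dense Zariski-open subset of the parameter space. After a change of coordinates, the homogeneous coordinate ring of $\mathbb{P}^n$ is $K[x_0,\dots,x_n]$ and the ideal of $\Pi_i$ is $(x_i,f_i)$ with $f_i=a_{i,0}x_0+\dots+a_{i,n}x_n$, where $a_{i,j}=0$ if and only if $i=j$. For each $j=0,\dots,n$ there is a unique hypersurface of degree $n-1$ in $\mathbb{P}^n$ containing the $n$ subspaces $\Pi_i$, $i\ne j$; $Q_j$ denotes both this hypersurface and a form defining it. $\mathcal{L}_n$ is the linear system (vector space) of forms of degree $n$ vanishing on $\Pi_0\cup\dots\cup\Pi_n$, and $v_n$ is the rational map from $\mathbb{P}^n$ to $\mathbb{P}^N$, $N+1=\dim\mathcal{L}_n$, given by $\mathcal{L}_n$. *)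

theory Defs
  imports "HOL-Library.Poly_Mapping" "HOL-Algebra.Algebraic_Closure_Type"
begin

text \<open>
  A polynomial over \<open>'a\<close> in variables of type \<open>'v\<close> is a finitely supported map from exponent
  vectors to coefficients; the product on \<open>\<Rightarrow>\<^sub>0\<close> is the usual convolution product.
\<close>

type_synonym ('v, 'a) mpoly = "('v \<Rightarrow>\<^sub>0 nat) \<Rightarrow>\<^sub>0 'a"

definition poly_ring :: "'v set \<Rightarrow> ('v, 'a::zero) mpoly set" where
  "poly_ring V = {F. \<forall>m\<in>Poly_Mapping.keys F. Poly_Mapping.keys m \<subseteq> V}"

text \<open>The forms of degree \<open>d\<close> (including \<open>0\<close>) in \<open>K[x\<^sub>0,\<dots>,x\<^sub>n]\<close>.\<close>

definition forms :: "nat \<Rightarrow> nat \<Rightarrow> (nat, 'a::zero) mpoly set" where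
  "forms n d = {F \<in> poly_ring {..n}.
     \<forall>m\<in>Poly_Mapping.keys F. (\<Sum>v\<in>Poly_Mapping.keys m. Poly_Mapping.lookup m v) = d}"

definition var :: "'v \<Rightarrow> ('v, 'a::zero_neq_one) mpoly" where
  "var v = Poly_Mapping.single (Poly_Mapping.single v 1) 1"

definition peval :: "('v \<Rightarrow> 'a::comm_semiring_1) \<Rightarrow> ('v, 'a) mpoly \<Rightarrow> 'a" where
  "peval y F = (\<Sum>m\<in>Poly_Mapping.keys F. Poly_Mapping.lookup F m *
     (\<Prod>v\<in>Poly_Mapping.keys m. y v ^ Poly_Mapping.lookup m v))"

text \<open>Evaluation of a polynomial over \<open>K\<close> at a point with coordinates in the algebraic closure.\<close>

definition geval :: "('v \<Rightarrow> 'a::field alg_closure) \<Rightarrow> ('v, 'a) mpoly \<Rightarrow> 'a alg_closure" where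
  "geval y F = peval y (Poly_Mapping.map to_ac F)"

definition psmult :: "'a::field \<Rightarrow> ('v, 'a) mpoly \<Rightarrow> ('v, 'a) mpoly" where
  "psmult c F = Poly_Mapping.single 0 c * F"

interpretation mpoly: vector_space psmult
  by unfold_locales
    (simp_all add: psmult_def algebra_simps single_add mult_single flip: mult.assoc)

definition basis_family ::
    "nat set \<Rightarrow> (nat \<Rightarrow> ('v, 'a::field) mpoly) \<Rightarrow> ('v, 'a) mpoly set \<Rightarrow> bool" where
  "basis_family I s L \<longleftrightarrow>
     inj_on s I \<and> mpoly.independent (s ` I) \<and> mpoly.span (s ` I) = L"


text \<open>
  A point of \<open>\<bbbP>\<^sup>n\<close> is represented by its vectors of homogeneous coordinates, and a subset of
  \<open>\<bbbP>\<^sup>n\<close> by the set of all homogeneous coordinate vectors of its points. Points are geometric,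
  i.e. have coordinates in the algebraic closure of the ground field \<open>K\<close>.
\<close>

definition proj_points :: "nat \<Rightarrow> (nat \<Rightarrow> 'b::zero) set" where
  "proj_points n = {y. (\<exists>i\<le>n. y i \<noteq> 0) \<and> (\<forall>i>n. y i = 0)}"

definition zero_locus :: "nat \<Rightarrow> (nat, 'a::field) mpoly set \<Rightarrow> (nat \<Rightarrow> 'a alg_closure) set" where
  "zero_locus n S = {y \<in> proj_points n. \<forall>F\<in>S. geval y F = 0}"

definition vanishes_on ::
    "(nat, 'a::field) mpoly \<Rightarrow> (nat \<Rightarrow> 'a alg_closure) set \<Rightarrow> bool" where
  "vanishes_on F Z \<longleftrightarrow> (\<forall>y\<in>Z. geval y F = 0)"

text \<open>
  Meant for nonempty \<open>Z\<close>: as \<open>Z\<close> is closed under scaling and \<open>K\<close> will be infinite, this is the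
  homogeneous ideal of \<open>Z\<close>.
\<close>

definition vanishing_ideal ::
    "nat \<Rightarrow> (nat \<Rightarrow> 'a::field alg_closure) set \<Rightarrow> (nat, 'a) mpoly set" where
  "vanishing_ideal n Z = {F \<in> poly_ring {..n}. vanishes_on F Z}"

definition ideal2 ::
    "nat \<Rightarrow> (nat, 'a::field) mpoly \<Rightarrow> (nat, 'a) mpoly \<Rightarrow> (nat, 'a) mpoly set" where
  "ideal2 n f g = {p * f + q * g | p q. p \<in> poly_ring {..n} \<and> q \<in> poly_ring {..n}}"

text \<open>The linear subspaces of \<open>\<bbbP>\<^sup>n\<close> of codimension 2 that are defined over \<open>K\<close>.\<close>

definition codim2_subspaces :: "nat \<Rightarrow> (nat \<Rightarrow> 'a::field alg_closure) set set" where
  "codim2_subspaces n = {zero_locus n {l, m} | l m.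
     l \<in> forms n 1 \<and> m \<in> forms n 1 \<and> l \<noteq> m \<and> mpoly.independent {l, m}}"

text \<open>
  The parameter space: tuples \<open>(\<Lambda>\<^sub>0,\<dots>,\<Lambda>\<^sub>n)\<close>, that is, the product of \<open>n + 1\<close> Grassmannians
  (\<open>\<Lambda>\<close>, as \<open>\<Pi>\<close> is the dependent function space).
\<close>

definition params :: "nat \<Rightarrow> (nat \<Rightarrow> (nat \<Rightarrow> 'a::field alg_closure) set) set" where
  "params n = (\<Pi>\<^sub>E i\<in>{..n}. codim2_subspaces n)"

text \<open>
  A coefficient array \<open>b\<close> describes the tuple whose \<open>i\<close>-th member is cut out by the two linear
  forms with coefficients \<open>b (i, 0, _)\<close> and \<open>b (i, 1, _)\<close>; it is a frame if for every \<open>i\<close> these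
  two forms are linearly independent.
\<close>

definition row_form :: "nat \<Rightarrow> (nat \<times> nat \<times> nat \<Rightarrow> 'a::field) \<Rightarrow> nat \<Rightarrow> nat \<Rightarrow> (nat, 'a) mpoly" where
  "row_form n b i e = (\<Sum>j\<le>n. psmult (b (i, e, j)) (var j))"

definition is_frame :: "nat \<Rightarrow> (nat \<times> nat \<times> nat \<Rightarrow> 'a::field) \<Rightarrow> bool" where
  "is_frame n b \<longleftrightarrow> (\<forall>i\<le>n. row_form n b i 0 \<noteq> row_form n b i 1 \<and>
     mpoly.independent {row_form n b i 0, row_form n b i 1})"

definition frame_tuple ::
    "nat \<Rightarrow> (nat \<times> nat \<times> nat \<Rightarrow> 'a::field) \<Rightarrow> nat \<Rightarrow> (nat \<Rightarrow> 'a alg_closure) set" where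
  "frame_tuple n b = (\<lambda>i\<in>{..n}. zero_locus n {row_form n b i 0, row_form n b i 1})"

text \<open>
  The map from frames to tuples of subspaces is a Zariski-locally trivial torsor under a power of
  \<open>GL\<^sub>2\<close>. Hence the Zariski topology on the parameter space is the quotient topology: a set of
  tuples is open iff the set of its frames is open, i.e. is the locus among all frames where some
  member of a set \<open>S\<close> of polynomials in the coefficients does not vanish.
\<close>

definition zariski_open :: "nat \<Rightarrow> (nat \<Rightarrow> (nat \<Rightarrow> 'a::field alg_closure) set) set \<Rightarrow> bool" where
  "zariski_open n U \<longleftrightarrow> U \<subseteq> params n \<and>
     (\<exists>S \<subseteq> poly_ring ({..n} \<times> {..1} \<times> {..n}). \<forall>b :: nat \<times> nat \<times> nat \<Rightarrow> 'a.
        is_frame n b \<longrightarrow> (frame_tuple n b \<in> U \<longleftrightarrow> (\<exists>p\<in>S. peval b p \<noteq> 0)))"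

definition zariski_dense :: "nat \<Rightarrow> (nat \<Rightarrow> (nat \<Rightarrow> 'a::field alg_closure) set) set \<Rightarrow> bool" where
  "zariski_dense n U \<longleftrightarrow> (\<forall>W. zariski_open n W \<and> W \<noteq> {} \<longrightarrow> U \<inter> W \<noteq> {})"

definition for_general ::
    "nat \<Rightarrow> ((nat \<Rightarrow> (nat \<Rightarrow> 'a::field alg_closure) set) \<Rightarrow> bool) \<Rightarrow> bool" where
  "for_general n P \<longleftrightarrow> (\<exists>U. zariski_open n U \<and> zariski_dense n U \<and> (\<forall>\<Lambda>\<in>U. P \<Lambda>))"


text \<open>
  Linear coordinates \<open>x\<^sub>0,\<dots>,x\<^sub>n\<close> on \<open>\<bbbP>\<^sup>n\<close> (as forms in the initial coordinates) for which the
  ideal of \<open>\<Lambda>\<^sub>i\<close> is \<open>(x\<^sub>i, f\<^sub>i)\<close> with \<open>f\<^sub>i = \<Sum>\<^sub>j a\<^sub>i\<^sub>j x\<^sub>j\<close> and \<open>a\<^sub>i\<^sub>j = 0\<close> iff \<open>i = j\<close>.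
\<close>

definition adapted_coords ::
    "nat \<Rightarrow> (nat \<Rightarrow> (nat \<Rightarrow> 'a::field alg_closure) set) \<Rightarrow>
     (nat \<Rightarrow> (nat, 'a) mpoly) \<Rightarrow> (nat \<Rightarrow> nat \<Rightarrow> 'a) \<Rightarrow> bool" where
  "adapted_coords n \<Lambda> x a \<longleftrightarrow>
     basis_family {..n} x (forms n 1) \<and>
     (\<forall>i\<le>n. \<forall>j\<le>n. a i j = 0 \<longleftrightarrow> i = j) \<and>
     (\<forall>i\<le>n. vanishing_ideal n (\<Lambda> i) = ideal2 n (x i) (\<Sum>j\<le>n. psmult (a i j) (x j)))"

text \<open>A hypersurface, as an effective divisor, is given by the set of all its defining forms.\<close>

definition hypersurface :: "(nat, 'a::field) mpoly \<Rightarrow> (nat, 'a) mpoly set" where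
  "hypersurface F = {psmult c F | c. c \<noteq> 0}"

definition Q_forms ::
    "nat \<Rightarrow> (nat \<Rightarrow> (nat \<Rightarrow> 'a::field alg_closure) set) \<Rightarrow> nat \<Rightarrow> (nat, 'a) mpoly set" where
  "Q_forms n \<Lambda> j = {F \<in> forms n (n - 1). F \<noteq> 0 \<and> (\<forall>i\<in>{..n} - {j}. vanishes_on F (\<Lambda> i))}"

definition lin_system ::
    "nat \<Rightarrow> (nat \<Rightarrow> (nat \<Rightarrow> 'a::field alg_closure) set) \<Rightarrow> (nat, 'a) mpoly set" where
  "lin_system n \<Lambda> = {F \<in> forms n n. vanishes_on F (\<Union>i\<le>n. \<Lambda> i)}"

text \<open>
  \<open>s\<^sub>0,\<dots>,s\<^sub>N\<close> represent a rational map from \<open>\<bbbP>\<^sup>n\<close> to \<open>\<bbbP>\<^sup>N\<close>, \<open>y \<mapsto> (s\<^sub>0(y) : \<dots> : s\<^sub>N(y))\<close>. Its image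
  is taken over the points at which not all \<open>s\<^sub>i\<close> vanish; the factor \<open>c\<close> runs through all
  homogeneous coordinate vectors of an image point.
\<close>

definition is_rational_map :: "nat \<Rightarrow> nat \<Rightarrow> (nat \<Rightarrow> (nat, 'a::field) mpoly) \<Rightarrow> bool" where
  "is_rational_map n N s \<longleftrightarrow> (\<exists>d. \<forall>i\<le>N. s i \<in> forms n d) \<and> (\<exists>i\<le>N. s i \<noteq> 0)"

definition rational_image ::
    "nat \<Rightarrow> nat \<Rightarrow> (nat \<Rightarrow> (nat, 'a::field) mpoly) \<Rightarrow> (nat \<Rightarrow> 'a alg_closure) set" where
  "rational_image n N s = {z \<in> proj_points N. \<exists>y\<in>proj_points n. \<exists>c. c \<noteq> 0 \<and>
     (\<forall>i\<le>N. z i = c * geval y (s i))}"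

definition hyperplanes :: "nat \<Rightarrow> (nat \<Rightarrow> 'b::field) set set" where
  "hyperplanes N = {{z \<in> proj_points N. (\<Sum>i\<le>N. c i * z i) = 0} | c. \<exists>i\<le>N. c i \<noteq> 0}"

end

theory Submission
  imports Defs "Jordan_Normal_Form.Determinant"
begin

text \<open>
  Let \<open>\<Pi>\<^sub>i\<close> be given by \<open>x\<^sub>i = f\<^sub>i = 0\<close> with \<open>f\<^sub>i = \<Sum>\<^sub>j a\<^sub>i\<^sub>j x\<^sub>j\<close>, and let \<open>e\<^sub>0, \<dots>, e\<^sub>n\<close> be the vertices of the
  coordinate simplex of \<open>x\<^sub>0, \<dots>, x\<^sub>n\<close>. The core of the proof is that a form \<open>F\<close> of degree \<open>n\<close> which
  vanishes on all \<open>\<Pi>\<^sub>i\<close> and at all \<open>e\<^sub>k\<close> is zero (\<open>form_vanishes_if_at_coordinate_points\<close>). Take a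
  point \<open>w\<close> and let \<open>T\<close> be the set of its nonzero coordinates. Inductively \<open>F\<close> vanishes at all points
  with smaller \<open>T\<close>. A line through \<open>w\<close> in the coordinate subspace of \<open>T\<close> meets each hyperplane
  \<open>x\<^sub>m = 0\<close>, \<open>m \<in> T\<close>, in a point with fewer nonzero coordinates, and each hyperplane \<open>f\<^sub>m = 0\<close>,
  \<open>m \<notin> T\<close>, in a point of \<open>\<Pi>\<^sub>m\<close>, because \<open>x\<^sub>m = 0\<close> on that subspace. For a general line these are
  \<open>n + 1\<close> distinct zeros of \<open>F\<close>, more than its degree, so that \<open>F(w) = 0\<close>. The zeros can be made
  distinct as soon as the linear forms involved are pairwise non-proportional on that subspace. If an
  \<open>x\<^sub>m\<close> is involved, this follows from \<open>a\<^sub>i\<^sub>j \<noteq> 0\<close> for \<open>i \<noteq> j\<close>; for two of the \<open>f\<^sub>m\<close> it is ensured by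
  nonzero 2 by 2 minors of \<open>(a\<^sub>i\<^sub>j)\<close>.

  Hence evaluation at the vertices embeds \<open>L\<^sub>n\<close> into \<open>K\<^sup>n\<^sup>+\<^sup>1\<close>. If \<open>D\<close> has degree \<open>n - 1\<close> and
  vanishes on the \<open>\<Pi>\<^sub>i\<close>, \<open>i \<noteq> j\<close>, and at \<open>e\<^sub>j\<close>, then \<open>x\<^sub>j D\<close> is an element of \<open>L\<^sub>n\<close> that vanishes at
  all vertices, so \<open>D = 0\<close>. This gives uniqueness of \<open>Q\<^sub>j\<close> and \<open>Q\<^sub>j(e\<^sub>j) \<noteq> 0\<close>. Existence of \<open>Q\<^sub>j\<close> comes
  from a determinant (\<open>determinantal_hypersurface\<close>). The form \<open>x\<^sub>i Q\<^sub>i\<close> vanishes at exactly the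
  vertices other than \<open>e\<^sub>i\<close>; so these \<open>n + 1\<close> forms are independent and, by the embedding, a basis.
  For other adapted coordinates of the same tuple, independence follows in the same way, and
  counting dimensions makes the products a basis again.

  A hyperplane containing the image of \<open>v\<^sub>n\<close> would be a linear relation, with coefficients in the
  algebraic closure, between the columns of the matrix of values of a basis of \<open>L\<^sub>n\<close> at the vertices.
  This matrix has entries in \<open>K\<close> and is invertible over \<open>K\<close> by the embedding, hence also over the
  closure.

  It remains to see that a general tuple has such coordinates. If the first form of every pair of
  a frame is taken as \<open>x\<^sub>i\<close>, then Cramer's rule expresses the second forms by the \<open>x\<^sub>j\<close>, and the
  conditions on the coefficients become non-vanishing of one polynomial in the frame
  (\<open>genericity\<close>). It is nonzero because it does not vanish for \<open>x\<^sub>i\<close> the given coordinates and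
  coefficients \<open>1 + i j\<close>.

  Throughout, \<open>K\<close> is infinite and the \<open>\<Pi>\<^sub>i\<close> are defined over \<open>K\<close>; this is why points with
  coordinates in \<open>K\<close> suffice to prove that a polynomial over \<open>K\<close> is zero.
\<close>

section \<open>Evaluation of polynomials\<close>

definition monom_eval :: "('v \<Rightarrow> 'b::comm_monoid_mult) \<Rightarrow> ('v \<Rightarrow>\<^sub>0 nat) \<Rightarrow> 'b" where
  "monom_eval y m = (\<Prod>v\<in>Poly_Mapping.keys m. y v ^ Poly_Mapping.lookup m v)"

text \<open>
  Evaluation with a map \<open>h\<close> applied to the coefficients. Evaluation over the ground field, over the
  algebraic closure and substitution of polynomials are the cases where \<open>h\<close> is the identity, the
  embedding into the closure and the embedding of constants, so each homomorphism property is proved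
  once.
\<close>

definition heval ::
    "('a::zero \<Rightarrow> 'b::comm_semiring_1) \<Rightarrow> ('v \<Rightarrow> 'b) \<Rightarrow> ('v, 'a) mpoly \<Rightarrow> 'b" where
  "heval h y F = (\<Sum>m\<in>Poly_Mapping.keys F. h (Poly_Mapping.lookup F m) * monom_eval y m)"

lemma monom_eval_superset:
  assumes "finite A" "Poly_Mapping.keys m \<subseteq> A"
  shows "monom_eval y m = (\<Prod>v\<in>A. y v ^ Poly_Mapping.lookup m v)"
  unfolding monom_eval_def
  by (rule prod.mono_neutral_left) (use assms in \<open>auto simp: in_keys_iff\<close>)

lemma monom_eval_add: "monom_eval y (m + m') = monom_eval y m * monom_eval y m'"
proof -
  let ?A = "Poly_Mapping.keys m \<union> Poly_Mapping.keys m'"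
  have "Poly_Mapping.keys (m + m') \<subseteq> ?A" by (rule Poly_Mapping.keys_add)
  then show ?thesis
    using monom_eval_superset[of ?A m y] monom_eval_superset[of ?A m' y]
      monom_eval_superset[of ?A "m + m'" y]
    by (simp add: lookup_add power_add prod.distrib)
qed

lemma monom_eval_zero [simp]: "monom_eval y 0 = 1"
  by (simp add: monom_eval_def)

lemma monom_eval_single [simp]: "monom_eval y (Poly_Mapping.single v k) = y v ^ k"
  by (simp add: monom_eval_def)

lemma poly_mapping_sum_singles:
  "F = (\<Sum>m\<in>Poly_Mapping.keys F. Poly_Mapping.single m (Poly_Mapping.lookup F m))"
proof (rule poly_mapping_eqI)
  fix k
  have "(\<Sum>m\<in>Poly_Mapping.keys F.
      Poly_Mapping.lookup (Poly_Mapping.single m (Poly_Mapping.lookup F m)) k) =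
    (\<Sum>m\<in>Poly_Mapping.keys F. if m = k then Poly_Mapping.lookup F k else 0)"
    by (rule sum.cong) (auto simp: lookup_single when_def)
  then show "Poly_Mapping.lookup F k = Poly_Mapping.lookup
      (\<Sum>m\<in>Poly_Mapping.keys F. Poly_Mapping.single m (Poly_Mapping.lookup F m)) k"
    by (simp add: lookup_sum in_keys_iff)
qed

context comm_ring_hom
begin

lemma heval_superset:
  assumes "finite A" "Poly_Mapping.keys F \<subseteq> A"
  shows "heval hom y F = (\<Sum>m\<in>A. hom (Poly_Mapping.lookup F m) * monom_eval y m)"
  unfolding heval_def
  by (rule sum.mono_neutral_left) (use assms in \<open>auto simp: in_keys_iff\<close>)

lemma heval_add: "heval hom y (F + G) = heval hom y F + heval hom y G"
proof -
  let ?A = "Poly_Mapping.keys F \<union> Poly_Mapping.keys G"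
  have "Poly_Mapping.keys (F + G) \<subseteq> ?A" by (rule Poly_Mapping.keys_add)
  then show ?thesis
    using heval_superset[of ?A F y] heval_superset[of ?A G y] heval_superset[of ?A "F + G" y]
    by (simp add: lookup_add hom_distribs algebra_simps sum.distrib)
qed

lemma heval_zero [simp]: "heval hom y 0 = 0"
  by (simp add: heval_def)

lemma heval_single [simp]: "heval hom y (Poly_Mapping.single m c) = hom c * monom_eval y m"
  by (simp add: heval_def)

lemma heval_sum: "heval hom y (\<Sum>i\<in>I. F i) = (\<Sum>i\<in>I. heval hom y (F i))"
  by (induction I rule: infinite_finite_induct) (simp_all add: heval_add)

lemma heval_mult: "heval hom y (F * G) = heval hom y F * heval hom y G"
proof -
  have "F * G = (\<Sum>m\<in>Poly_Mapping.keys F. \<Sum>m'\<in>Poly_Mapping.keys G.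
      Poly_Mapping.single (m + m') (Poly_Mapping.lookup F m * Poly_Mapping.lookup G m'))"
    by (subst poly_mapping_sum_singles[of F], subst poly_mapping_sum_singles[of G])
      (simp add: sum_product mult_single)
  then have "heval hom y (F * G) = (\<Sum>m\<in>Poly_Mapping.keys F. \<Sum>m'\<in>Poly_Mapping.keys G.
      (hom (Poly_Mapping.lookup F m) * monom_eval y m) *
      (hom (Poly_Mapping.lookup G m') * monom_eval y m'))"
    by (simp add: heval_sum monom_eval_add hom_distribs mult_ac)
  then show ?thesis by (simp add: heval_def sum_product)
qed

lemma comm_ring_hom_heval: "comm_ring_hom (heval hom y)"
proof -
  have "heval hom y 1 = 1"
    using heval_single[of y 0 1] by simp
  then show ?thesis
    by unfold_locales (simp_all add: heval_add heval_mult)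
qed

lemma hom_monom_eval: "hom (monom_eval y m) = monom_eval (\<lambda>v. hom (y v)) m"
  by (simp add: monom_eval_def hom_distribs)

lemma hom_heval: "hom (heval h y F) = heval (\<lambda>c. hom (h c)) (\<lambda>v. hom (y v)) F"
  by (simp add: heval_def hom_distribs hom_monom_eval)

end

lemma comm_ring_hom_ident: "comm_ring_hom (\<lambda>x. x)"
  by unfold_locales auto

lemma comm_ring_hom_to_ac: "comm_ring_hom to_ac"
  by unfold_locales auto

lemma comm_ring_hom_const: "comm_ring_hom (Poly_Mapping.single (0 :: 'm::comm_monoid_add))"
  by unfold_locales (auto simp: single_add mult_single)

lemma peval_eq_heval: "peval = heval (\<lambda>x. x)"
  by (intro ext) (simp add: peval_def heval_def monom_eval_def)

lemma geval_eq_heval: "geval = (heval to_ac :: ('v \<Rightarrow> 'a::field alg_closure) \<Rightarrow> _)"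
proof (rule ext, rule ext)
  fix y :: "'v \<Rightarrow> 'a alg_closure" and F :: "('v, 'a) mpoly"
  have keys: "Poly_Mapping.keys (Poly_Mapping.map to_ac F) = Poly_Mapping.keys F"
    by (auto simp: in_keys_iff Poly_Mapping.map.rep_eq when_def)
  have "Poly_Mapping.lookup (Poly_Mapping.map to_ac F) m = to_ac (Poly_Mapping.lookup F m)" for m
    by (simp add: Poly_Mapping.map.rep_eq when_def)
  then show "geval y F = heval to_ac y F"
    by (simp add: geval_def peval_def heval_def monom_eval_def keys)
qed

interpretation peval: comm_ring_hom "peval y" for y :: "'v \<Rightarrow> 'a::comm_ring_1"
  unfolding peval_eq_heval by (rule comm_ring_hom.comm_ring_hom_heval[OF comm_ring_hom_ident])

interpretation geval: comm_ring_hom "geval y" for y :: "'v \<Rightarrow> 'a::field alg_closure"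
  unfolding geval_eq_heval by (rule comm_ring_hom.comm_ring_hom_heval[OF comm_ring_hom_to_ac])

lemma peval_var [simp]: "peval y (var v) = (y v :: 'a::comm_ring_1)"
  by (simp add: var_def peval_eq_heval comm_ring_hom.heval_single[OF comm_ring_hom_ident])

lemma geval_var [simp]: "geval y (var v) = y v"
  by (simp add: var_def geval_eq_heval comm_ring_hom.heval_single[OF comm_ring_hom_to_ac])

lemma peval_psmult [simp]: "peval y (psmult c F) = c * peval y F"
  by (simp add: psmult_def hom_distribs)
    (simp add: peval_eq_heval comm_ring_hom.heval_single[OF comm_ring_hom_ident])

lemma geval_psmult [simp]: "geval y (psmult c F) = to_ac c * geval y F"
  by (simp add: psmult_def hom_distribs)
    (simp add: geval_eq_heval comm_ring_hom.heval_single[OF comm_ring_hom_to_ac])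

lemma geval_to_ac: "geval (\<lambda>v. to_ac (y v)) F = to_ac (peval y F)"
  by (simp add: geval_eq_heval peval_eq_heval comm_ring_hom.hom_heval[OF comm_ring_hom_to_ac])

definition psubst :: "('v \<Rightarrow> ('w, 'a) mpoly) \<Rightarrow> ('v, 'a::comm_ring_1) mpoly \<Rightarrow> ('w, 'a) mpoly"
  where "psubst \<sigma> = heval (Poly_Mapping.single 0) \<sigma>"

interpretation psubst: comm_ring_hom "psubst \<sigma>" for \<sigma> :: "'v \<Rightarrow> ('w, 'a::comm_ring_1) mpoly"
  unfolding psubst_def by (rule comm_ring_hom.comm_ring_hom_heval[OF comm_ring_hom_const])

lemma peval_psubst: "peval y (psubst \<sigma> F) = peval (\<lambda>v. peval y (\<sigma> v)) F"
proof -
  have "peval y (Poly_Mapping.single 0 c) = c" for c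
    by (simp add: peval_eq_heval comm_ring_hom.heval_single[OF comm_ring_hom_ident])
  then show ?thesis
    unfolding psubst_def using peval.hom_heval[of y "Poly_Mapping.single 0" \<sigma> F]
    by (simp add: peval_eq_heval)
qed


section \<open>Polynomials as functions\<close>

text \<open>
  Polynomial functions enter only through their restrictions to affine lines. This property is shared
  by polynomials and by linear functionals given as sums, and is all that general position arguments
  need.
\<close>

definition line_poly :: "(('v \<Rightarrow> 'a::field) \<Rightarrow> 'a) \<Rightarrow> bool" where
  "line_poly f \<longleftrightarrow> (\<forall>w u. \<exists>q. \<forall>t. poly q t = f (\<lambda>v. w v + t * u v))"

lemma peval_on_line:
  fixes F :: "('v, 'a::field) mpoly"
  obtains q where "\<And>t. poly q t = peval (\<lambda>v. w v + t * u v) F"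
    and "\<And>d. (\<And>m. m \<in> Poly_Mapping.keys F \<Longrightarrow>
      (\<Sum>v\<in>Poly_Mapping.keys m. Poly_Mapping.lookup m v) \<le> d) \<Longrightarrow> degree q \<le> d"
proof
  let ?q = "heval (\<lambda>c. [:c:]) (\<lambda>v. [:w v, u v:]) F"
  show "poly ?q t = peval (\<lambda>v. w v + t * u v) F" for t
  proof -
    have "comm_ring_hom (\<lambda>p :: 'a poly. poly p t)"
      by unfold_locales auto
    from comm_ring_hom.hom_heval[OF this, of "\<lambda>c. [:c:]" "\<lambda>v. [:w v, u v:]" F]
    show ?thesis by (simp add: peval_eq_heval)
  qed
  fix d
  assume d: "\<And>m. m \<in> Poly_Mapping.keys F \<Longrightarrow>
      (\<Sum>v\<in>Poly_Mapping.keys m. Poly_Mapping.lookup m v) \<le> d"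
  have "degree ([:c:] * monom_eval (\<lambda>v. [:w v, u v:]) m) \<le> d"
    if m: "m \<in> Poly_Mapping.keys F" for m c
  proof -
    have "degree (monom_eval (\<lambda>v. [:w v, u v:]) m) \<le>
        (\<Sum>v\<in>Poly_Mapping.keys m. degree ([:w v, u v:] ^ Poly_Mapping.lookup m v))"
      unfolding monom_eval_def using degree_prod_sum_le[of "Poly_Mapping.keys m"]
      by (simp add: o_def)
    also have "\<dots> \<le> (\<Sum>v\<in>Poly_Mapping.keys m. Poly_Mapping.lookup m v)"
    proof (rule sum_mono)
      fix v
      have "degree ([:w v, u v:] ^ Poly_Mapping.lookup m v) \<le>
          degree [:w v, u v:] * Poly_Mapping.lookup m v"
        by (rule degree_power_le)
      also have "\<dots> \<le> 1 * Poly_Mapping.lookup m v"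
        by (rule mult_right_mono) auto
      finally show "degree ([:w v, u v:] ^ Poly_Mapping.lookup m v) \<le> Poly_Mapping.lookup m v"
        by simp
    qed
    also note d[OF m]
    finally show ?thesis using degree_smult_le[of c] order_trans by auto
  qed
  then show "degree ?q \<le> d"
    unfolding heval_def by (intro degree_sum_le) auto
qed

lemma line_poly_peval: "line_poly (\<lambda>y. peval y F)"
  unfolding line_poly_def using peval_on_line by metis

text \<open>
  Points in general position: join a point that is good for all but one of the functions to a point
  that is good for the remaining one. On the connecting line each function is a nonzero polynomial in
  the parameter, and so has finitely many zeros.
\<close>

lemma line_poly_common_nonzero:
  fixes f :: "'i \<Rightarrow> ('v \<Rightarrow> 'a::field_char_0) \<Rightarrow> 'a"
  assumes "finite I" "\<And>i. i \<in> I \<Longrightarrow> line_poly (f i)" "\<And>i. i \<in> I \<Longrightarrow> \<exists>y. f i y \<noteq> 0"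
  obtains y where "\<And>i. i \<in> I \<Longrightarrow> f i y \<noteq> 0"
proof -
  have "\<exists>y. \<forall>i\<in>I. f i y \<noteq> 0"
    using assms
  proof (induction I rule: finite_induct)
    case (insert j I)
    obtain y where y: "\<forall>i\<in>I. f i y \<noteq> 0" using insert by auto
    obtain z where z: "f j z \<noteq> 0" using insert.prems by auto
    have "\<exists>q. \<forall>t. poly q t = f i (\<lambda>v. y v + t * (z v - y v))" if "i \<in> insert j I" for i
      using insert.prems(1)[OF that] unfolding line_poly_def by fast
    then obtain q where
      q: "poly (q i) t = f i (\<lambda>v. y v + t * (z v - y v))" if "i \<in> insert j I" for i t
      by metis
    have "poly (q i) 0 \<noteq> 0" if "i \<in> I" for i using y q that by simp
    moreover have "poly (q j) 1 \<noteq> 0" using z q by simp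
    ultimately have "\<forall>i\<in>insert j I. q i \<noteq> 0" by (metis insert_iff poly_0)
    then have "prod q (insert j I) \<noteq> 0" using insert.hyps by simp
    then have "finite {t. poly (prod q (insert j I)) t = 0}" by (rule poly_roots_finite)
    then obtain t where "poly (prod q (insert j I)) t \<noteq> 0"
      by (metis (mono_tags, lifting) UNIV_eq_I infinite_UNIV_char_0 mem_Collect_eq)
    then have "\<forall>i\<in>insert j I. poly (q i) t \<noteq> 0"
      using insert.hyps by (auto simp: poly_prod)
    then show ?case using q by metis
  qed simp
  then show ?thesis using that by blast
qed

text \<open>
  Kronecker's substitution \<open>y\<^sub>v = t ^ w v\<close> turns a polynomial into a univariate one without
  cancellation if the weights separate its monomials.
\<close>

lemma separating_weights:
  fixes M :: "('v \<Rightarrow> nat) set"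
  assumes "finite V" "finite M"
  shows "\<exists>w :: 'v \<Rightarrow> nat. \<forall>m\<in>M. \<forall>m'\<in>M.
    (\<Sum>v\<in>V. w v * m v) = (\<Sum>v\<in>V. w v * m' v) \<longrightarrow> (\<forall>v\<in>V. m v = m' v)"
  using assms(1)
proof (induction V rule: finite_induct)
  case (insert x V)
  then obtain w :: "'v \<Rightarrow> nat" where w: "\<forall>m\<in>M. \<forall>m'\<in>M.
    (\<Sum>v\<in>V. w v * m v) = (\<Sum>v\<in>V. w v * m' v) \<longrightarrow> (\<forall>v\<in>V. m v = m' v)" by blast
  define s where "s m = (\<Sum>v\<in>V. w v * m v)" for m :: "'v \<Rightarrow> nat"
  \<comment> \<open>The new variable gets a weight above every total weight so far, so that division by \<open>B\<close> recovers its exponent.\<close>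
  define B where "B = Suc (\<Sum>m\<in>M. s m)"
  have B: "s m < B" if "m \<in> M" for m
    unfolding B_def using member_le_sum[OF that, of s] assms(2) by simp
  have s': "(\<Sum>v\<in>insert x V. (w(x := B)) v * m v) = s m + m x * B" for m
  proof -
    have "(\<Sum>v\<in>V. (w(x := B)) v * m v) = s m"
      unfolding s_def by (rule sum.cong) (use insert.hyps in auto)
    then show ?thesis using insert.hyps by (simp add: mult.commute)
  qed
  have "\<forall>v\<in>insert x V. m v = m' v" if m: "m \<in> M" "m' \<in> M"
    and eq: "s m + m x * B = s m' + m' x * B" for m m'
  proof -
    have "B \<noteq> 0" by (simp add: B_def)
    have "(s m + m x * B) div B = m x" "(s m' + m' x * B) div B = m' x"
      using B[OF m(1)] B[OF m(2)] \<open>B \<noteq> 0\<close> by simp_all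
    then have "m x = m' x" using eq by simp
    moreover from this have "s m = s m'" using eq by simp
    ultimately show ?thesis using w m by (simp add: s_def)
  qed
  then have "\<forall>m\<in>M. \<forall>m'\<in>M. (\<Sum>v\<in>insert x V. (w(x := B)) v * m v) =
     (\<Sum>v\<in>insert x V. (w(x := B)) v * m' v) \<longrightarrow> (\<forall>v\<in>insert x V. m v = m' v)"
    unfolding s' by blast
  then show ?case by blast
qed simp

lemma mpoly_eq_zero_if_peval_zero:
  fixes F :: "('v, 'a::field_char_0) mpoly"
  assumes "\<And>y. peval y F = 0"
  shows "F = 0"
proof (rule ccontr)
  assume "F \<noteq> 0"
  then obtain m0 where m0: "m0 \<in> Poly_Mapping.keys F"
    by (metis keys_eq_empty ex_in_conv)
  define V where "V = \<Union> (Poly_Mapping.keys ` Poly_Mapping.keys F)"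
  have "finite V" by (simp add: V_def)
  obtain w :: "'v \<Rightarrow> nat" where w: "\<forall>m\<in>Poly_Mapping.lookup ` Poly_Mapping.keys F.
      \<forall>m'\<in>Poly_Mapping.lookup ` Poly_Mapping.keys F.
      (\<Sum>v\<in>V. w v * m v) = (\<Sum>v\<in>V. w v * m' v) \<longrightarrow> (\<forall>v\<in>V. m v = m' v)"
    using separating_weights[OF \<open>finite V\<close>, of "Poly_Mapping.lookup ` Poly_Mapping.keys F"] by auto
  define W where "W m = (\<Sum>v\<in>V. w v * Poly_Mapping.lookup m v)" for m
  have V: "Poly_Mapping.keys m \<subseteq> V" if "m \<in> Poly_Mapping.keys F" for m
    using that by (auto simp: V_def)
  have inj: "m = m'" if "m \<in> Poly_Mapping.keys F" "m' \<in> Poly_Mapping.keys F" "W m = W m'" for m m'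
  proof (rule poly_mapping_eqI)
    fix v show "Poly_Mapping.lookup m v = Poly_Mapping.lookup m' v"
    proof (cases "v \<in> V")
      case True
      then show ?thesis using w that unfolding W_def by blast
    next
      case False
      then show ?thesis using V that by (metis in_keys_iff subsetD)
    qed
  qed
  define q where "q = (\<Sum>m\<in>Poly_Mapping.keys F. Polynomial.monom (Poly_Mapping.lookup F m) (W m))"
  have "poly q t = 0" for t
  proof -
    have "monom_eval (\<lambda>v. t ^ w v) m = t ^ W m" if "m \<in> Poly_Mapping.keys F" for m
      unfolding monom_eval_superset[OF \<open>finite V\<close> V[OF that]] W_def
      by (simp add: power_sum power_mult)
    then have "poly q t = peval (\<lambda>v. t ^ w v) F"
      by (simp add: q_def poly_sum poly_monom peval_eq_heval heval_def)
    then show ?thesis using assms by simp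
  qed
  then have "q = 0" using poly_all_0_iff_0 by blast
  have "coeff q (W m0) = (\<Sum>m\<in>Poly_Mapping.keys F. if m = m0 then Poly_Mapping.lookup F m else 0)"
    unfolding q_def coeff_sum by (rule sum.cong) (use inj m0 in auto)
  also have "\<dots> = Poly_Mapping.lookup F m0" using m0 by simp
  finally show False using \<open>q = 0\<close> m0 by (simp add: in_keys_iff)
qed

lemma mpoly_eqI:
  fixes F G :: "('v, 'a::field_char_0) mpoly"
  assumes "\<And>y. peval y F = peval y G"
  shows "F = G"
  using mpoly_eq_zero_if_peval_zero[of "F - G"] assms by (simp add: hom_distribs)

section \<open>Graded pieces of the polynomial ring\<close>

definition mdeg :: "('v \<Rightarrow>\<^sub>0 nat) \<Rightarrow> nat" where
  "mdeg m = (\<Sum>v\<in>Poly_Mapping.keys m. Poly_Mapping.lookup m v)"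

lemma mdeg_add: "mdeg (m + m') = mdeg m + mdeg m'"
proof -
  let ?A = "Poly_Mapping.keys m \<union> Poly_Mapping.keys m'"
  have sup: "mdeg k = (\<Sum>v\<in>?A. Poly_Mapping.lookup k v)" if "Poly_Mapping.keys k \<subseteq> ?A" for k
    unfolding mdeg_def
    by (rule sum.mono_neutral_left) (use that in \<open>auto simp: in_keys_iff\<close>)
  show ?thesis
    using sup[of m] sup[of m'] sup[of "m + m'"] Poly_Mapping.keys_add[of m m']
    by (simp add: lookup_add sum.distrib)
qed

lemma in_forms_iff:
  "F \<in> forms n d \<longleftrightarrow>
     (\<forall>m\<in>Poly_Mapping.keys F. Poly_Mapping.keys m \<subseteq> {..n} \<and> mdeg m = d)"
  by (auto simp: forms_def poly_ring_def mdeg_def)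

lemma forms_in_poly_ring: "F \<in> forms n d \<Longrightarrow> F \<in> poly_ring {..n}"
  by (simp add: forms_def)

lemma poly_ring_zero [simp]: "0 \<in> poly_ring V"
  by (simp add: poly_ring_def)

lemma poly_ring_const [simp]: "Poly_Mapping.single 0 c \<in> poly_ring V"
  by (simp add: poly_ring_def)

lemma poly_ring_one [simp]: "1 \<in> poly_ring V"
  unfolding single_one[symmetric] by (rule poly_ring_const)

lemma poly_ring_var [simp]: "v \<in> V \<Longrightarrow> var v \<in> poly_ring V"
  by (simp add: poly_ring_def var_def)

lemma poly_ring_add: "F \<in> poly_ring V \<Longrightarrow> G \<in> poly_ring V \<Longrightarrow> F + G \<in> poly_ring V"
  using Poly_Mapping.keys_add[of F G] by (fastforce simp: poly_ring_def)

lemma poly_ring_uminus: "(F :: ('v, 'a::comm_ring_1) mpoly) \<in> poly_ring V \<Longrightarrow> - F \<in> poly_ring V"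
  by (simp add: poly_ring_def in_keys_iff)

lemma poly_ring_diff:
  "(F :: ('v, 'a::comm_ring_1) mpoly) \<in> poly_ring V \<Longrightarrow> G \<in> poly_ring V \<Longrightarrow> F - G \<in> poly_ring V"
  using poly_ring_add[of F V "- G"] poly_ring_uminus[of G V] by simp

lemma poly_ring_mult:
  assumes "F \<in> poly_ring V" "G \<in> poly_ring V"
  shows "F * G \<in> poly_ring V"
  unfolding poly_ring_def
proof safe
  fix m v
  assume "m \<in> Poly_Mapping.keys (F * G)" and v: "v \<in> Poly_Mapping.keys m"
  then obtain a b where "m = a + b" "a \<in> Poly_Mapping.keys F" "b \<in> Poly_Mapping.keys G"
    using keys_mult[of F G] by auto
  then show "v \<in> V"
    using assms v Poly_Mapping.keys_add[of a b] by (fastforce simp: poly_ring_def)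
qed

lemma poly_ring_psmult: "F \<in> poly_ring V \<Longrightarrow> psmult c F \<in> poly_ring V"
  by (simp add: psmult_def poly_ring_mult)

lemma poly_ring_sum: "(\<And>i. i \<in> I \<Longrightarrow> F i \<in> poly_ring V) \<Longrightarrow> sum F I \<in> poly_ring V"
  by (induction I rule: infinite_finite_induct) (auto intro: poly_ring_add)

lemma poly_ring_prod: "(\<And>i. i \<in> I \<Longrightarrow> F i \<in> poly_ring V) \<Longrightarrow> prod F I \<in> poly_ring V"
  by (induction I rule: infinite_finite_induct) (auto intro: poly_ring_mult)

lemma forms_zero [simp]: "0 \<in> forms n d"
  by (simp add: in_forms_iff)

lemma forms_const [simp]: "Poly_Mapping.single 0 c \<in> forms n 0"
  by (simp add: in_forms_iff mdeg_def)

lemma forms_var [simp]: "v \<le> n \<Longrightarrow> var v \<in> forms n 1"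
  by (simp add: in_forms_iff var_def mdeg_def)

lemma forms_add: "F \<in> forms n d \<Longrightarrow> G \<in> forms n d \<Longrightarrow> F + G \<in> forms n d"
  using Poly_Mapping.keys_add[of F G] by (fastforce simp: in_forms_iff)

lemma forms_uminus: "(F :: (nat, 'a::comm_ring_1) mpoly) \<in> forms n d \<Longrightarrow> - F \<in> forms n d"
  by (simp add: in_forms_iff in_keys_iff)

lemma forms_diff:
  "(F :: (nat, 'a::comm_ring_1) mpoly) \<in> forms n d \<Longrightarrow> G \<in> forms n d \<Longrightarrow> F - G \<in> forms n d"
  using forms_add[of F n d "- G"] forms_uminus[of G n d] by simp

lemma forms_mult:
  assumes "F \<in> forms n d" "G \<in> forms n e"
  shows "F * G \<in> forms n (d + e)"
  unfolding in_forms_iff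
proof
  fix m
  assume "m \<in> Poly_Mapping.keys (F * G)"
  then obtain a b where "m = a + b" "a \<in> Poly_Mapping.keys F" "b \<in> Poly_Mapping.keys G"
    using keys_mult[of F G] by auto
  then show "Poly_Mapping.keys m \<subseteq> {..n} \<and> mdeg m = d + e"
    using assms Poly_Mapping.keys_add[of a b] by (fastforce simp: in_forms_iff mdeg_add)
qed

lemma forms_psmult: "F \<in> forms n d \<Longrightarrow> psmult c F \<in> forms n d"
  using forms_mult[OF forms_const, of F n d c] by (simp add: psmult_def)

lemma forms_sum: "(\<And>i. i \<in> I \<Longrightarrow> F i \<in> forms n d) \<Longrightarrow> sum F I \<in> forms n d"
  by (induction I rule: infinite_finite_induct) (auto intro: forms_add)

lemma forms_prod:
  "finite I \<Longrightarrow> (\<And>i. i \<in> I \<Longrightarrow> F i \<in> forms n (d i)) \<Longrightarrow> prod F I \<in> forms n (sum d I)"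
proof (induction I rule: finite_induct)
  case empty
  show ?case unfolding prod.empty sum.empty single_one[symmetric] by (rule forms_const)
qed (auto intro: forms_mult)

lemma peval_cong:
  assumes "F \<in> poly_ring V" "\<And>v. v \<in> V \<Longrightarrow> y v = z v"
  shows "peval y F = peval z F"
  unfolding peval_def
proof (rule sum.cong[OF refl])
  fix m
  assume "m \<in> Poly_Mapping.keys F"
  then have "y v = z v" if "v \<in> Poly_Mapping.keys m" for v
    using assms that unfolding poly_ring_def by blast
  then have "(\<Prod>v\<in>Poly_Mapping.keys m. y v ^ Poly_Mapping.lookup m v) =
      (\<Prod>v\<in>Poly_Mapping.keys m. z v ^ Poly_Mapping.lookup m v)"
    by (intro prod.cong) simp_all
  then show "Poly_Mapping.lookup F m * (\<Prod>v\<in>Poly_Mapping.keys m. y v ^ Poly_Mapping.lookup m v) =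
      Poly_Mapping.lookup F m * (\<Prod>v\<in>Poly_Mapping.keys m. z v ^ Poly_Mapping.lookup m v)"
    by simp
qed

lemma peval_form_on_line:
  fixes F :: "(nat, 'a::field) mpoly"
  assumes "F \<in> forms n d"
  obtains q where "degree q \<le> d" "\<And>t. poly q t = peval (\<lambda>v. w v + t * u v) F"
proof -
  obtain q where q: "\<And>t. poly q t = peval (\<lambda>v. w v + t * u v) F"
    and deg: "\<And>d. (\<And>m. m \<in> Poly_Mapping.keys F \<Longrightarrow>
      (\<Sum>v\<in>Poly_Mapping.keys m. Poly_Mapping.lookup m v) \<le> d) \<Longrightarrow> degree q \<le> d"
    using peval_on_line[of w u F] by blast
  have "degree q \<le> d"
    by (rule deg) (use assms in \<open>simp add: forms_def\<close>)
  then show ?thesis using q that by blast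
qed

lemma peval_form_scale:
  assumes "F \<in> forms n d"
  shows "peval (\<lambda>v. t * y v) F = t ^ d * peval y F"
proof -
  have "monom_eval (\<lambda>v. t * y v) m = t ^ mdeg m * monom_eval y m" for m
    by (simp add: monom_eval_def mdeg_def power_mult_distrib prod.distrib power_sum)
  then show ?thesis
    using assms unfolding in_forms_iff
    by (simp add: peval_eq_heval heval_def sum_distrib_left algebra_simps)
qed

section \<open>Linear forms\<close>

definition lin :: "nat \<Rightarrow> (nat \<Rightarrow> 'a::field) \<Rightarrow> (nat, 'a) mpoly" where
  "lin n c = (\<Sum>j\<le>n. psmult (c j) (var j))"

lemma peval_lin [simp]: "peval y (lin n c) = (\<Sum>j\<le>n. c j * y j)"
  by (simp add: lin_def hom_distribs)

lemma lin_in_forms [simp]: "lin n c \<in> forms n 1"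
  unfolding lin_def by (intro forms_sum forms_psmult forms_var) simp

text \<open>
  The exponent vectors of total degree 1 are the unit vectors, so coefficients can be read off there.
\<close>

lemma linear_form_eq_lin:
  assumes "F \<in> forms n 1"
  shows "F = lin n (\<lambda>j. Poly_Mapping.lookup F (Poly_Mapping.single j 1))"
proof (rule poly_mapping_eqI)
  fix m
  have psmult_var: "psmult c (var j) = Poly_Mapping.single (Poly_Mapping.single j 1) c"
    for c :: 'a and j :: nat
    by (simp add: psmult_def var_def mult_single)
  let ?c = "\<lambda>j. Poly_Mapping.lookup F (Poly_Mapping.single j 1)"
  have *: "Poly_Mapping.lookup (lin n ?c) m =
      (\<Sum>j\<le>n. if Poly_Mapping.single j 1 = m then Poly_Mapping.lookup F m else 0)"
    unfolding lin_def lookup_sum psmult_var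
    by (rule sum.cong) (auto simp: lookup_single when_def)
  show "Poly_Mapping.lookup F m = Poly_Mapping.lookup (lin n ?c) m"
  proof (cases "\<exists>j\<le>n. m = Poly_Mapping.single j 1")
    case True
    then obtain j where j: "j \<le> n" "m = Poly_Mapping.single j 1" by blast
    have "(Poly_Mapping.single i (1::nat) = m) \<longleftrightarrow> i = j" for i
      using j(2) by (metis keys_single singleton_inject zero_neq_one)
    then show ?thesis using * j(1) by simp
  next
    case False
    have "m \<notin> Poly_Mapping.keys F"
    proof
      assume m: "m \<in> Poly_Mapping.keys F"
      have d: "mdeg m = 1" and k: "Poly_Mapping.keys m \<subseteq> {..n}"
        using m assms by (auto simp: in_forms_iff)
      then have "Poly_Mapping.keys m \<noteq> {}" by (auto simp: mdeg_def)
      then obtain j where j: "j \<in> Poly_Mapping.keys m" by blast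
      have "mdeg m = Poly_Mapping.lookup m j +
          (\<Sum>v\<in>Poly_Mapping.keys m - {j}. Poly_Mapping.lookup m v)"
        unfolding mdeg_def using j by (simp add: sum.remove)
      moreover have "Poly_Mapping.lookup m j \<noteq> 0" using j by (simp add: in_keys_iff)
      ultimately have "Poly_Mapping.lookup m j = 1"
        and "(\<Sum>v\<in>Poly_Mapping.keys m - {j}. Poly_Mapping.lookup m v) = 0"
        using d by linarith+
      then have *: "\<forall>v\<in>Poly_Mapping.keys m - {j}. Poly_Mapping.lookup m v = 0"
        by (subst (asm) sum_eq_0_iff) auto
      have "Poly_Mapping.lookup m v = Poly_Mapping.lookup (Poly_Mapping.single j 1) v" for v
      proof (cases "v = j")
        case True
        then show ?thesis using \<open>Poly_Mapping.lookup m j = 1\<close> by simp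
      next
        case False
        then have "Poly_Mapping.lookup m v = 0"
          using *[THEN bspec, of v] by (cases "v \<in> Poly_Mapping.keys m") (auto simp: in_keys_iff)
        then show ?thesis using False by (simp add: lookup_single)
      qed
      then have "m = Poly_Mapping.single j 1" by (rule poly_mapping_eqI)
      then show False using False j k by auto
    qed
    moreover have "Poly_Mapping.lookup (lin n ?c) m = 0"
      unfolding * using False by (intro sum.neutral) auto
    ultimately show ?thesis by (simp add: in_keys_iff)
  qed
qed

lemma lin_eq_zeroD: "lin n c = 0 \<Longrightarrow> j \<le> n \<Longrightarrow> c j = 0"
proof -
  assume "lin n c = 0" and j: "j \<le> n"
  then have "peval (\<lambda>v. if v = j then 1 else 0) (lin n c) = 0" by simp
  then show "c j = 0" using j by (simp add: if_distrib[of "\<lambda>x. _ * x"] cong: if_cong)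
qed

lemma lin_cong: "(\<And>j. j \<le> n \<Longrightarrow> c j = d j) \<Longrightarrow> lin n c = lin n d"
  unfolding lin_def by (rule sum.cong) auto

lemma lin_sum: "(\<Sum>i\<in>I. psmult (c i) (lin n (C i))) = lin n (\<lambda>k. \<Sum>i\<in>I. c i * C i k)"
  unfolding lin_def mpoly.scale_sum_right mpoly.scale_sum_left mpoly.scale_scale
  by (rule sum.swap)

lemma row_form_eq_lin: "row_form n b i e = lin n (\<lambda>j. b (i, e, j))"
  by (simp add: row_form_def lin_def)

section \<open>Bases in coefficients\<close>

text \<open>
  Independence of a family, in which repeated members are dependent; for the set of its members
  this needs injectivity in addition.
\<close>

definition indep_family :: "'i set \<Rightarrow> ('i \<Rightarrow> ('v, 'a::field) mpoly) \<Rightarrow> bool" where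
  "indep_family I s \<longleftrightarrow> (\<forall>c. (\<Sum>i\<in>I. psmult (c i) (s i)) = 0 \<longrightarrow> (\<forall>i\<in>I. c i = 0))"

lemma indep_family_iff:
  fixes s :: "'i \<Rightarrow> ('v, 'a::field) mpoly"
  assumes "finite I"
  shows "indep_family I s \<longleftrightarrow> inj_on s I \<and> mpoly.independent (s ` I)"
proof
  assume ind: "indep_family I s"
  have inj: "inj_on s I"
  proof (rule inj_onI, rule ccontr)
    fix i j
    assume ij: "i \<in> I" "j \<in> I" "s i = s j" "i \<noteq> j"
    define c :: "'i \<Rightarrow> 'a" where "c k = (if k = i then 1 else if k = j then -1 else 0)" for k
    have "(\<Sum>k\<in>I. psmult (c k) (s k)) = (\<Sum>k\<in>{i, j}. psmult (c k) (s k))"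
      by (rule sum.mono_neutral_right) (use assms ij in \<open>auto simp: c_def\<close>)
    also have "\<dots> = 0" using ij by (simp add: c_def)
    finally have "c i = 0" using ind ij unfolding indep_family_def by blast
    then show False by (simp add: c_def)
  qed
  moreover have "mpoly.independent (s ` I)"
  proof (rule ccontr)
    assume "\<not> ?thesis"
    then obtain u where u: "\<exists>v\<in>s ` I. u v \<noteq> 0" "(\<Sum>v\<in>s ` I. psmult (u v) v) = 0"
      using mpoly.dependent_finite[of "s ` I"] assms by auto
    then have "(\<Sum>i\<in>I. psmult (u (s i)) (s i)) = 0"
      using inj by (simp add: sum.reindex)
    then have "\<forall>i\<in>I. u (s i) = 0"
      using ind[unfolded indep_family_def, THEN spec, of "\<lambda>i. u (s i)"] by blast
    then show False using u(1) by blast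
  qed
  ultimately show "inj_on s I \<and> mpoly.independent (s ` I)" ..
next
  assume *: "inj_on s I \<and> mpoly.independent (s ` I)"
  show "indep_family I s"
    unfolding indep_family_def
  proof (intro allI impI ballI)
    fix c i
    assume 0: "(\<Sum>i\<in>I. psmult (c i) (s i)) = 0" and i: "i \<in> I"
    have "(\<Sum>v\<in>s ` I. psmult (c (inv_into I s v)) v) = 0"
      using * 0 by (simp add: sum.reindex)
    then have "c (inv_into I s (s i)) = 0"
      using mpoly.independentD[of "s ` I" "s ` I" "\<lambda>v. c (inv_into I s v)" "s i"] * i assms by auto
    then show "c i = 0" using * i by simp
  qed
qed

lemma span_family:
  assumes "finite I" "inj_on s I"
  shows "mpoly.span (s ` I) = range (\<lambda>c. \<Sum>i\<in>I. psmult (c i) (s i))"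
proof -
  have 1: "(\<Sum>i\<in>I. psmult (c i) (s i)) = (\<Sum>v\<in>s ` I. psmult (c (inv_into I s v)) v)" for c
    using assms by (simp add: sum.reindex)
  have 2: "(\<Sum>v\<in>s ` I. psmult (u v) v) = (\<Sum>i\<in>I. psmult (u (s i)) (s i))" for u
    using assms by (simp add: sum.reindex)
  show ?thesis
    unfolding mpoly.span_finite[OF finite_imageI[OF assms(1)]]
  proof (intro subset_antisym image_subsetI)
    fix u
    show "(\<Sum>v\<in>s ` I. psmult (u v) v) \<in> range (\<lambda>c. \<Sum>i\<in>I. psmult (c i) (s i))"
      unfolding 2 by (rule rangeI)
  next
    fix c
    show "(\<Sum>i\<in>I. psmult (c i) (s i)) \<in> range (\<lambda>u. \<Sum>v\<in>s ` I. psmult (u v) v)"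
      unfolding 1 by (rule rangeI)
  qed
qed

lemma basis_family_iff:
  assumes "finite I"
  shows "basis_family I s L \<longleftrightarrow>
    indep_family I s \<and> L = range (\<lambda>c. \<Sum>i\<in>I. psmult (c i) (s i))"
  using indep_family_iff[OF assms] span_family[OF assms] unfolding basis_family_def by blast

text \<open>
  An independent family in \<open>L\<close> with as many members as a basis spans \<open>L\<close>: otherwise another vector
  could be added, and the enlarged independent set would have more elements than a spanning set.
\<close>

lemma basis_familyI_card:
  assumes s: "basis_family I s L" "finite I" and t: "indep_family J t" "finite J"
    and "\<And>j. j \<in> J \<Longrightarrow> t j \<in> L" and card: "card J = card I"
  shows "basis_family J t L"
proof -
  have tJ: "inj_on t J" "mpoly.independent (t ` J)" using t indep_family_iff by auto
  have sI: "inj_on s I" "mpoly.independent (s ` I)" "mpoly.span (s ` I) = L"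
    using s by (auto simp: basis_family_def)
  have sub: "t ` J \<subseteq> mpoly.span (s ` I)" using assms(5) sI by auto
  have "v \<in> mpoly.span (t ` J)" if v: "v \<in> mpoly.span (s ` I)" for v
  proof (rule ccontr)
    assume new: "v \<notin> mpoly.span (t ` J)"
    then have "mpoly.independent (insert v (t ` J))"
      using mpoly.independent_insertI tJ(2) by blast
    moreover have "insert v (t ` J) \<subseteq> mpoly.span (s ` I)" using sub v by blast
    ultimately have "card (insert v (t ` J)) \<le> card (s ` I)"
      using mpoly.independent_span_bound[OF finite_imageI[OF s(2)]] by blast
    moreover have "v \<notin> t ` J" using new mpoly.span_base by blast
    ultimately show False
      using card tJ(1) sI(1) t(2) by (simp add: card_image)
  qed
  then have "mpoly.span (t ` J) = L"
    using sI(3) mpoly.span_minimal[OF sub] by auto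
  then show ?thesis using tJ by (simp add: basis_family_def)
qed

lemma independent_pair_iff:
  fixes l m :: "('v, 'b::field) mpoly"
  shows
  "l \<noteq> m \<and> mpoly.independent {l, m} \<longleftrightarrow>
     (\<forall>c d. psmult c l + psmult d m = 0 \<longrightarrow> c = 0 \<and> d = 0)"
proof -
  let ?s = "\<lambda>b. if b then l else m"
  have "l \<noteq> m \<and> mpoly.independent {l, m} \<longleftrightarrow> indep_family UNIV ?s"
    unfolding indep_family_iff[OF finite_UNIV] by (auto simp: inj_on_def UNIV_bool insert_commute)
  also have "\<dots> \<longleftrightarrow> (\<forall>c d. psmult c l + psmult d m = 0 \<longrightarrow> c = 0 \<and> d = 0)"
  proof
    assume *: "indep_family UNIV ?s"
    show "\<forall>c d. psmult c l + psmult d m = 0 \<longrightarrow> c = 0 \<and> d = 0"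
    proof (intro allI impI)
      fix c d :: 'b
      assume 0: "psmult c l + psmult d m = 0"
      have "(\<Sum>i\<in>UNIV. psmult (if i then c else d) (?s i)) = psmult c l + psmult d m"
        by (simp add: UNIV_bool add.commute)
      with 0 have "\<forall>i\<in>UNIV. (if i then c else d) = 0"
        using *[unfolded indep_family_def, THEN spec, of "\<lambda>i. if i then c else d"] by simp
      from this[THEN bspec, of True] this[THEN bspec, of False] show "c = 0 \<and> d = 0"
        by simp
    qed
  next
    assume *: "\<forall>c d. psmult c l + psmult d m = 0 \<longrightarrow> c = 0 \<and> d = 0"
    show "indep_family UNIV ?s"
      unfolding indep_family_def
    proof (intro allI impI)
      fix c :: "bool \<Rightarrow> 'b"
      assume "(\<Sum>i\<in>UNIV. psmult (c i) (?s i)) = 0"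
      then have "psmult (c True) l + psmult (c False) m = 0"
        by (simp add: UNIV_bool add.commute)
      then show "\<forall>i\<in>UNIV. c i = 0" using * by (simp add: UNIV_bool)
    qed
  qed
  finally show ?thesis .
qed

text \<open>
  If \<open>u, v\<close> are independent combinations of \<open>r, s\<close>, the determinant \<open>D\<close> of the 2 by 2 coefficient
  matrix is nonzero, and Cramer's rule expresses \<open>r, s\<close> by \<open>u, v\<close>.
\<close>

lemma independent_pair_exchange:
  assumes ind: "\<And>c d. psmult c u + psmult d v = 0 \<Longrightarrow> c = 0 \<and> d = 0"
    and u: "u = psmult \<alpha> r + psmult \<beta> s" and v: "v = psmult \<gamma> r + psmult \<delta> s"
  obtains c d c' d' where "r = psmult c u + psmult d v" "s = psmult c' u + psmult d' v"
proof -
  define D where "D = \<alpha> * \<delta> - \<beta> * \<gamma>"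
  have r: "psmult \<delta> u + psmult (- \<beta>) v = psmult D r"
    and s: "psmult (- \<gamma>) u + psmult \<alpha> v = psmult D s"
    unfolding u v D_def by (simp_all add: algebra_simps mult.commute)
  have "D \<noteq> 0"
  proof
    assume "D = 0"
    then have "\<delta> = 0 \<and> - \<beta> = 0" "- \<gamma> = 0 \<and> \<alpha> = 0"
      using ind[of \<delta> "- \<beta>"] ind[of "- \<gamma>" \<alpha>] r s by simp_all
    then have "u = 0" using u by simp
    then show False using ind[of 1 0] by simp
  qed
  show ?thesis
  proof
    have "psmult (1 / D) (psmult \<delta> u + psmult (- \<beta>) v) = r"
      unfolding r using \<open>D \<noteq> 0\<close> by simp
    then show "r = psmult (\<delta> / D) u + psmult (- \<beta> / D) v"
      by (simp add: mpoly.scale_right_distrib mpoly.scale_right_diff_distrib)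
    have "psmult (1 / D) (psmult (- \<gamma>) u + psmult \<alpha> v) = s"
      unfolding s using \<open>D \<noteq> 0\<close> by simp
    then show "s = psmult (- \<gamma> / D) u + psmult (\<alpha> / D) v"
      by (simp add: mpoly.scale_right_distrib mpoly.scale_right_diff_distrib)
  qed
qed

section \<open>Linear coordinates\<close>

text \<open>
  Row \<open>k\<close> of \<open>E\<close> expresses the \<open>k\<close>-th initial coordinate by new ones, so this is the point whose new
  coordinates are \<open>w\<close>.
\<close>

definition point :: "nat \<Rightarrow> (nat \<Rightarrow> nat \<Rightarrow> 'a::field) \<Rightarrow> (nat \<Rightarrow> 'a) \<Rightarrow> nat \<Rightarrow> 'a" where
  "point n E w k = (if k \<le> n then \<Sum>l\<le>n. E k l * w l else 0)"

lemma point_line: "point n E (\<lambda>l. w l + t * u l) = (\<lambda>k. point n E w k + t * point n E u k)"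
  by (intro ext) (simp add: point_def sum_distrib_left algebra_simps sum.distrib)

locale linear_coordinates =
  fixes n :: nat and x :: "nat \<Rightarrow> (nat, 'a::field_char_0) mpoly" and E :: "nat \<Rightarrow> nat \<Rightarrow> 'a"
  assumes basis: "basis_family {..n} x (forms n 1)"
    and var_eq: "\<And>k. k \<le> n \<Longrightarrow> var k = (\<Sum>i\<le>n. psmult (E k i) (x i))"
    and dual: "\<And>w i. i \<le> n \<Longrightarrow> peval (point n E w) (x i) = w i"
begin

lemma x_form: "i \<le> n \<Longrightarrow> x i \<in> forms n 1"
  using basis mpoly.span_base[of "x i" "x ` {..n}"] by (auto simp: basis_family_def)

abbreviation vertex :: "nat \<Rightarrow> nat \<Rightarrow> 'a" where
  "vertex j \<equiv> point n E (\<lambda>k. if k = j then 1 else 0)"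

lemma x_nonzero: "i \<le> n \<Longrightarrow> x i \<noteq> 0"
  using dual[of i "\<lambda>_. 1"] by auto

lemma nonzero_point: "i \<le> n \<Longrightarrow> w i \<noteq> 0 \<Longrightarrow> \<exists>k\<le>n. point n E w k \<noteq> 0"
proof (rule ccontr)
  assume i: "i \<le> n" "w i \<noteq> 0" and "\<not> ?thesis"
  then have "point n E w = point n E (\<lambda>_. 0)"
    by (auto simp: fun_eq_iff point_def)
  then show False using dual[OF i(1), of w] dual[OF i(1), of "\<lambda>_. 0"] i(2) by simp
qed

text \<open>
  The two points agree at the indices \<open>0..n\<close>, since \<open>E\<close> expresses the variables by the \<open>x\<^sub>i\<close>.
\<close>

lemma peval_at_own_coordinates:
  assumes "F \<in> poly_ring {..n}"
  shows "peval (point n E (\<lambda>i. peval y (x i))) F = peval y F"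
proof -
  have "point n E (\<lambda>i. peval y (x i)) k = y k" if "k \<le> n" for k
    using arg_cong[OF var_eq[OF that], of "peval y"] that by (simp add: hom_distribs point_def)
  then show ?thesis by (intro peval_cong[OF assms]) simp
qed

end

text \<open>
  A basis \<open>x\<close> of the linear forms and the matrix \<open>A\<close> of its coefficients: the variables are
  combinations of the \<open>x\<^sub>i\<close> with some coefficients \<open>E\<close>, and substituting this into the \<open>x\<^sub>i\<close> shows that
  \<open>A E\<close> is the identity, by independence.
\<close>

lemma linear_coordinates_exist:
  fixes x :: "nat \<Rightarrow> (nat, 'a::field_char_0) mpoly"
  assumes x: "basis_family {..n} x (forms n 1)"
  obtains E where "linear_coordinates n x E"
proof -
  have ind: "indep_family {..n} x"
    and span: "forms n 1 = range (\<lambda>c. \<Sum>i\<le>n. psmult (c i) (x i))"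
    using x basis_family_iff[of "{..n}" x "forms n 1"] by auto
  have "\<exists>c. var k = (\<Sum>i\<le>n. psmult (c i) (x i))" if "k \<le> n" for k
    using forms_var[OF that] span by auto
  then obtain E where E: "\<And>k. k \<le> n \<Longrightarrow> var k = (\<Sum>i\<le>n. psmult (E k i) (x i))"
    by metis
  have xf: "x i \<in> forms n 1" if "i \<le> n" for i
    using x that mpoly.span_base[of "x i" "x ` {..n}"] by (auto simp: basis_family_def)
  define A where "A i k = Poly_Mapping.lookup (x i) (Poly_Mapping.single k 1)" for i k
  have A: "x i = lin n (A i)" if "i \<le> n" for i
    unfolding A_def by (rule linear_form_eq_lin[OF xf[OF that]])
  have inv: "(\<Sum>k\<le>n. A i k * E k l) = (if l = i then 1 else 0)" if i: "i \<le> n" and l: "l \<le> n" for i l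
  proof -
    have "x i = (\<Sum>k\<le>n. psmult (A i k) (\<Sum>l\<le>n. psmult (E k l) (x l)))"
      using A[OF i] E by (simp add: lin_def)
    also have "\<dots> = (\<Sum>l\<le>n. psmult (\<Sum>k\<le>n. A i k * E k l) (x l))"
      unfolding mpoly.scale_sum_right mpoly.scale_sum_left mpoly.scale_scale by (rule sum.swap)
    finally have "(\<Sum>l\<le>n. psmult ((\<Sum>k\<le>n. A i k * E k l) - (if l = i then 1 else 0)) (x l)) = 0"
      using i by (simp add: mpoly.scale_left_diff_distrib sum_subtractf if_distrib[of "\<lambda>c. psmult c _"]
          cong: if_cong)
    then show ?thesis using ind l unfolding indep_family_def by auto
  qed
  have "linear_coordinates n x E"
  proof (rule linear_coordinates.intro[OF x])
    show "var k = (\<Sum>i\<le>n. psmult (E k i) (x i))" if "k \<le> n" for k by (rule E[OF that])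
    show "peval (point n E w) (x i) = w i" if i: "i \<le> n" for w i
    proof -
      have "peval (point n E w) (x i) = (\<Sum>k\<le>n. A i k * (\<Sum>l\<le>n. E k l * w l))"
        by (simp add: A[OF i] point_def)
      also have "\<dots> = (\<Sum>l\<le>n. (\<Sum>k\<le>n. A i k * E k l) * w l)"
        unfolding sum_distrib_left sum_distrib_right mult.assoc by (rule sum.swap)
      also have "\<dots> = (\<Sum>l\<le>n. if l = i then w l else 0)"
        by (rule sum.cong) (use inv i in auto)
      finally show ?thesis using i by simp
    qed
  qed
  then show ?thesis by (rule that)
qed

section \<open>Forms of degree \<open>n\<close> vanishing on the \<open>\<Pi>\<^sub>i\<close> and at the coordinate points\<close>

text \<open>
  The 2 by 2 minors of \<open>c\<close> that avoid the diagonal: for the linear forms with the rows of \<open>c\<close> as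
  coefficients, the \<open>i\<close>-th and the \<open>j\<close>-th are not proportional on the coordinate line of \<open>k\<close> and \<open>l\<close>.
\<close>

definition minors_nonzero :: "nat \<Rightarrow> (nat \<Rightarrow> nat \<Rightarrow> 'a::comm_ring) \<Rightarrow> bool" where
  "minors_nonzero n c \<longleftrightarrow> (\<forall>i\<le>n. \<forall>j\<le>n. \<forall>k\<le>n. \<forall>l\<le>n. i \<noteq> j \<and> k \<noteq> l \<and> k \<notin> {i, j} \<and> l \<notin> {i, j} \<longrightarrow>
     c i k * c j l \<noteq> c i l * c j k)"

text \<open>
  The core of the proof, with \<open>\<phi> w\<close> the value of the form at the point with coordinates \<open>w\<close>. On the
  coordinate subspace of the support \<open>T\<close> of \<open>w\<close>, consider the \<open>n + 1\<close> linear forms \<open>x\<^sub>m\<close> for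
  \<open>m \<in> T\<close> and \<open>f\<^sub>m\<close> for \<open>m \<notin> T\<close>. At a zero of any of them \<open>\<phi>\<close> vanishes, by induction on the support
  or because the point lies on \<open>\<Pi>\<^sub>m\<close>. If \<open>w\<close> is such a zero, nothing is left to prove; otherwise a
  general line through \<open>w\<close> meets their zero sets in \<open>n + 1\<close> distinct points.
\<close>

lemma form_vanishes_if_at_coordinate_points:
  fixes \<phi> :: "(nat \<Rightarrow> 'a::field_char_0) \<Rightarrow> 'a" and a :: "nat \<Rightarrow> nat \<Rightarrow> 'a"
  assumes line: "\<And>w u. \<exists>q. degree q \<le> n \<and> (\<forall>t. poly q t = \<phi> (\<lambda>k. w k + t * u k))"
    and a: "\<And>i j. i \<le> n \<Longrightarrow> j \<le> n \<Longrightarrow> a i j = 0 \<longleftrightarrow> i = j"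
    and minors: "minors_nonzero n a"
    and van: "\<And>i w. i \<le> n \<Longrightarrow> w i = 0 \<Longrightarrow> (\<Sum>j\<le>n. a i j * w j) = 0 \<Longrightarrow> \<phi> w = 0"
    and unit: "\<And>k w. k \<le> n \<Longrightarrow> (\<And>j. j \<le> n \<Longrightarrow> j \<noteq> k \<Longrightarrow> w j = 0) \<Longrightarrow> \<phi> w = 0"
  shows "\<phi> w = 0"
proof (induction "card {k. k \<le> n \<and> w k \<noteq> 0}" arbitrary: w rule: less_induct)
  case less
  define T where "T = {k. k \<le> n \<and> w k \<noteq> 0}"
  have finT [simp]: "finite T" by (simp add: T_def)
  have Tn: "k \<le> n" if "k \<in> T" for k using that by (simp add: T_def)
  \<comment> \<open>\<open>l m\<close> is the restriction of \<open>x\<^sub>m\<close> or \<open>f\<^sub>m\<close> to the coordinate subspace of \<open>T\<close>, and \<open>L m\<close> its coefficients.\<close>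
  define L :: "nat \<Rightarrow> nat \<Rightarrow> 'a"
    where "L m k = (if m \<in> T then if k = m then 1 else 0 else a m k)" for m k
  define l where "l m u = (\<Sum>k\<in>T. L m k * u k)" for m and u :: "nat \<Rightarrow> 'a"
  have l_in: "l m u = u m" if "m \<in> T" for m u
    using that by (simp add: l_def L_def if_distrib[of "\<lambda>c. c * _"] cong: if_cong)
  have l_out: "l m u = (\<Sum>k\<le>n. a m k * u k)"
    if "m \<notin> T" "\<And>k. k \<le> n \<Longrightarrow> k \<notin> T \<Longrightarrow> u k = 0" for m u
    unfolding l_def L_def using that
    by (intro sum.mono_neutral_cong_left) (auto simp: Tn)
  have l_line: "l m (\<lambda>k. u k + t * v k) = l m u + t * l m v" for m t u v
    by (simp add: l_def algebra_simps sum.distrib sum_distrib_left)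
  have l_unit: "l m (\<lambda>i. if i = k then 1 else 0) = L m k" if "k \<in> T" for m k
    using that by (simp add: l_def if_distrib[of "\<lambda>c. _ * c"] cong: if_cong)
  show "\<phi> w = 0"
  proof (cases "(\<exists>m\<le>n. l m w = 0) \<or> (\<exists>k\<le>n. T \<subseteq> {k})")
    case True
    then show ?thesis
    proof
      assume "\<exists>m\<le>n. l m w = 0"
      then obtain m where m: "m \<le> n" "l m w = 0" by blast
      then have "m \<notin> T" using l_in[of m w] by (auto simp: T_def)
      then show ?thesis using van[of m w] m l_out[of m w] by (auto simp: T_def)
    next
      assume "\<exists>k\<le>n. T \<subseteq> {k}"
      then obtain k where k: "k \<le> n" "T \<subseteq> {k}" by blast
      show ?thesis by (rule unit[OF k(1)]) (use k(2) in \<open>auto simp: T_def\<close>)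
    qed
  next
    case False
    then have lw: "l m w \<noteq> 0" if "m \<le> n" for m using that by blast
    have "\<exists>k'\<in>T. k' \<noteq> k" if "k \<le> n" for k using False that by blast
    then have two: "\<exists>k'\<in>T. k' \<noteq> k" if "k \<in> T" for k using Tn that by blast
    have "T \<noteq> {}" using False by auto
    \<comment> \<open>\<open>u\<close> is a good direction if no \<open>l m u\<close> is zero (the line meets \<open>l m = 0\<close>) and the parameters
      \<open>- l m w / l m u\<close> of the intersections differ. For \<open>m \<noteq> m'\<close> the latter says that \<open>g (m, m')\<close> is
      nonzero at \<open>u\<close>, and as \<open>l m w\<close> and \<open>l m' w\<close> are nonzero, this linear form in \<open>u\<close> is zero only
      if \<open>l m\<close> and \<open>l m'\<close> are proportional.\<close>
    define g where "g mm u = (case mm of (m, m') \<Rightarrow>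
      if m = m' then l m u else l m w * l m' u - l m' w * l m u)" for mm u
    have nonprop: "\<exists>k\<in>T. \<exists>k'\<in>T. L m k * L m' k' \<noteq> L m k' * L m' k"
      if m: "m \<le> n" "m' \<le> n" "m \<noteq> m'" for m m'
    proof -
      have one: "\<exists>k\<in>T. \<exists>k'\<in>T. L m k * L m' k' \<noteq> L m k' * L m' k"
        if m: "m \<le> n" "m' \<le> n" "m \<noteq> m'" "m \<in> T" for m m'
      proof -
        obtain k' where k': "k' \<in> T" "k' \<noteq> m" "L m' k' \<noteq> 0"
        proof (cases "m' \<in> T")
          case True
          then show ?thesis using that[of m'] m by (simp add: L_def)
        next
          case False
          obtain k' where "k' \<in> T" "k' \<noteq> m" using two m by blast
          then show ?thesis using that[of k'] False a[of m' k'] m Tn[of k'] by (auto simp: L_def)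
        qed
        then have "L m m * L m' k' \<noteq> L m k' * L m' m" using m by (simp add: L_def)
        then show ?thesis using m k' by blast
      qed
      consider "m \<in> T" | "m' \<in> T" | "m \<notin> T" "m' \<notin> T" by blast
      then show ?thesis
      proof cases
        case 1
        then show ?thesis using one m by blast
      next
        case 2
        then obtain k k' where "k \<in> T" "k' \<in> T" "L m' k * L m k' \<noteq> L m' k' * L m k"
          using one[of m' m] m by blast
        then show ?thesis by (metis mult.commute)
      next
        case 3
        obtain k where "k \<in> T" using \<open>T \<noteq> {}\<close> by blast
        moreover obtain k' where "k' \<in> T" "k' \<noteq> k" using two \<open>k \<in> T\<close> by blast
        moreover have "a m k * a m' k' \<noteq> a m k' * a m' k"
          using minors 3 m calculation Tn unfolding minors_nonzero_def by blast
        ultimately show ?thesis using 3 by (auto simp: L_def)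
      qed
    qed
    obtain u0 where u0: "\<And>mm. mm \<in> {..n} \<times> {..n} \<Longrightarrow> g mm u0 \<noteq> 0"
    proof (rule line_poly_common_nonzero[of "{..n} \<times> {..n}" g])
      fix mm
      assume "mm \<in> {..n} \<times> {..n}"
      then obtain m m' where mm: "mm = (m, m')" "m \<le> n" "m' \<le> n" by auto
      have "g mm (\<lambda>k. u k + t * v k) = g mm u + t * g mm v" for t u v
        by (simp add: g_def mm l_line algebra_simps)
      then have "\<forall>t. poly [:g mm u, g mm v:] t = g mm (\<lambda>k. u k + t * v k)" for u v
        by simp
      then show "line_poly (g mm)"
        unfolding line_poly_def by blast
      show "\<exists>u. g mm u \<noteq> 0"
      proof (rule ccontr)
        assume "\<not> ?thesis"
        then have 0: "g mm u = 0" for u by blast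
        then have "m \<noteq> m'" using lw[of m] 0[of w] mm by (auto simp: g_def)
        then obtain k k' where k: "k \<in> T" "k' \<in> T" "L m k * L m' k' \<noteq> L m k' * L m' k"
          using nonprop mm by blast
        have e: "l m w * L m' k = l m' w * L m k" if "k \<in> T" for k
          using 0[of "\<lambda>i. if i = k then 1 else 0"] \<open>m \<noteq> m'\<close> that by (simp add: g_def mm l_unit)
        have "l m w * (L m k * L m' k') = L m k * (l m w * L m' k')"
          by (rule mult.left_commute)
        also have "\<dots> = L m k' * (l m w * L m' k)"
          unfolding e[OF k(1)] e[OF k(2)] by (simp only: mult_ac)
        also have "\<dots> = l m w * (L m k' * L m' k)"
          by (rule mult.left_commute)
        finally have "l m w * (L m k * L m' k') = l m w * (L m k' * L m' k)" .
        then show False using k(3) lw[OF mm(2)] by simp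
      qed
    qed auto
    \<comment> \<open>The forms \<open>l m\<close> only see the indices in \<open>T\<close>, so the direction may be moved into the subspace.\<close>
    define u where "u k = (if k \<in> T then u0 k else 0)" for k
    have lu: "l m u = l m u0" for m
      unfolding l_def by (rule sum.cong) (simp_all add: u_def)
    have lu0: "l m u \<noteq> 0" if "m \<le> n" for m
      using u0[of "(m, m)"] that by (simp add: g_def lu)
    have distinct: "l m w * l m' u \<noteq> l m' w * l m u" if "m \<le> n" "m' \<le> n" "m \<noteq> m'" for m m'
      using u0[of "(m, m')"] that by (simp add: g_def lu)
    define t where "t m = - l m w / l m u" for m
    have inj: "inj_on t {..n}"
    proof (rule inj_onI, rule ccontr)
      fix m m'
      assume m: "m \<in> {..n}" "m' \<in> {..n}" "t m = t m'" "m \<noteq> m'"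
      then have "l m w / l m u = l m' w / l m' u" by (simp add: t_def)
      then have "l m w * l m' u = l m' w * l m u"
        using lu0[of m] lu0[of m'] m by (simp add: frac_eq_eq)
      then show False using distinct[of m m'] m by simp
    qed
    obtain q where q: "degree q \<le> n" "\<And>t. poly q t = \<phi> (\<lambda>k. w k + t * u k)"
      using line[of w u] by blast
    have "poly q (t m) = 0" if m: "m \<le> n" for m
    proof -
      define w' where "w' k = w k + t m * u k" for k
      have supp: "w' k = 0" if "k \<le> n" "k \<notin> T" for k
        using that by (simp add: w'_def u_def T_def)
      have lw': "l m w' = 0"
        unfolding w'_def l_line using lu0[OF m] by (simp add: t_def)
      have "\<phi> w' = 0"
      proof (cases "m \<in> T")
        case True
        then have "w' m = 0" using lw' l_in by simp
        then have "{k. k \<le> n \<and> w' k \<noteq> 0} \<subset> T" using supp True by blast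
        then have "card {k. k \<le> n \<and> w' k \<noteq> 0} < card {k. k \<le> n \<and> w k \<noteq> 0}"
          using psubset_card_mono[OF finT] by (simp add: T_def)
        then show ?thesis by (rule less.hyps)
      next
        case False
        then show ?thesis using van[OF m, of w'] supp[OF m] lw' l_out[OF False supp] by simp
      qed
      moreover have "w' = (\<lambda>k. w k + t m * u k)" by (simp add: w'_def fun_eq_iff)
      ultimately show ?thesis by (simp add: q(2))
    qed
    then have "q = 0"
      using poly_eqI_degree[of "t ` {..n}" q 0] q(1) card_image[OF inj] by auto
    then have "poly q 0 = 0" by simp
    then show ?thesis using q(2)[of 0] by simp
  qed
qed

section \<open>The hypersurfaces \<open>Q\<^sub>j\<close> as determinants\<close>

lemma mult_mat_vec_nth:
  "i < m \<Longrightarrow> (mat m (Suc n) f *\<^sub>v vec (Suc n) v) $ i = (\<Sum>k\<le>n. f (i, k) * v k)"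
  by (simp add: scalar_prod_def atLeast0LessThan lessThan_Suc_atMost)

text \<open>Every term of the Leibniz formula takes one entry from each row.\<close>

lemma det_in_forms:
  fixes M :: "(nat, 'a::field) mpoly mat"
  assumes M: "M \<in> carrier_mat m m"
    and "\<And>r k. r < m \<Longrightarrow> k < m \<Longrightarrow> M $$ (r, k) \<in> forms n (d r)"
  shows "det M \<in> forms n (\<Sum>r<m. d r)"
  unfolding det_def'[OF M] atLeast0LessThan
proof (rule forms_sum)
  fix \<sigma>
  assume "\<sigma> \<in> {p. p permutes {..<m}}"
  then have "\<sigma> permutes {..<m}" by simp
  then have "(\<Prod>i<m. M $$ (i, \<sigma> i)) \<in> forms n (\<Sum>r<m. d r)"
    using permutes_in_image[of \<sigma> "{..<m}"] by (intro forms_prod) (auto intro!: assms(2))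
  then show "signof \<sigma> * (\<Prod>i<m. M $$ (i, \<sigma> i)) \<in> forms n (\<Sum>r<m. d r)"
    by (auto simp: sign_def intro: forms_uminus)
qed

text \<open>
  The hyperplane spanned by \<open>\<Pi>\<^sub>i\<close> and a point \<open>y\<close> has the equation \<open>f\<^sub>i(y) x\<^sub>i - x\<^sub>i(y) f\<^sub>i = 0\<close>. The
  coefficient vectors of these equations for \<open>i \<noteq> j\<close> are the rows of an \<open>n\<close> by \<open>n + 1\<close> matrix of
  linear forms in \<open>y\<close> with \<open>(x\<^sub>0(y), \<dots>, x\<^sub>n(y))\<close> in its kernel, as \<open>y\<close> is on all the hyperplanes. So
  its maximal minors are proportional to the coordinates \<open>x\<^sub>k(y)\<close>, and the common factor \<open>Q\<^sub>j\<close>, of degree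
  \<open>n - 1\<close>, vanishes where the hyperplanes are dependent.

  The factor \<open>x\<^sub>p\<close>, \<open>p \<noteq> j\<close>, of the minor without column \<open>p\<close> can be cancelled explicitly: without that
  column, row \<open>p\<close> is \<open>-x\<^sub>p\<close> times the row of constants \<open>a\<^sub>p\<^sub>k\<close>. The matrix \<open>M\<close> in the proof is what
  remains, completed to the index set \<open>0..n\<close>: the row of constants is put at the free index \<open>j\<close>, and
  instead of deleting column \<open>p\<close>, row \<open>p\<close> is a unit vector.
\<close>

lemma (in linear_coordinates) determinantal_hypersurface:
  assumes a: "\<And>i j. i \<le> n \<Longrightarrow> j \<le> n \<Longrightarrow> a i j = 0 \<longleftrightarrow> i = j"
    and n: "n \<ge> 1" and j: "j \<le> n"
  defines "f \<equiv> \<lambda>i. \<Sum>k\<le>n. psmult (a i k) (x k)"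
  obtains Q where "Q \<in> forms n (n - 1)"
    and "peval (point n E (\<lambda>k. if k = j then 1 else 0)) Q \<noteq> 0"
    and "\<And>i y. i \<le> n \<Longrightarrow> i \<noteq> j \<Longrightarrow> y \<in> proj_points n \<Longrightarrow>
      geval y (x i) = 0 \<Longrightarrow> geval y (f i) = 0 \<Longrightarrow> geval y Q = 0"
proof -
  obtain p where p: "p \<le> n" "p \<noteq> j"
    using n by (metis le_zero_eq not_one_le_zero zero_le)
  define c where "c = (\<lambda>(r, k). if r = j then Poly_Mapping.single 0 (a p k)
     else if r = p then (if k = p then 1 else 0)
     else (if k = r then f r else 0) - psmult (a r k) (x r))"
  define M where "M = mat (Suc n) (Suc n) c"
  have M: "M \<in> carrier_mat (Suc n) (Suc n)" by (simp add: M_def)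
  have ff: "f i \<in> forms n 1" for i
    unfolding f_def by (intro forms_sum forms_psmult x_form) simp
  define d :: "nat \<Rightarrow> nat" where "d r = (if r = j \<or> r = p then 0 else 1)" for r
  have one: "1 \<in> forms n 0" unfolding single_one[symmetric] by (rule forms_const)
  note xf1 = x_form[unfolded One_nat_def] and ff1 = ff[unfolded One_nat_def]
  have "M $$ (r, k) \<in> forms n (d r)" if "r < Suc n" "k < Suc n" for r k
    using that
    by (auto simp: M_def c_def d_def one xf1 ff1 intro!: forms_diff forms_psmult forms_uminus)
  then have "det M \<in> forms n (\<Sum>r<Suc n. d r)" by (rule det_in_forms[OF M])
  moreover have "(\<Sum>r<Suc n. d r) = n - 1"
  proof -
    have "(\<Sum>r<Suc n. d r) = (\<Sum>r\<in>{..<Suc n} - {j, p}. 1)"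
      by (rule sum.mono_neutral_cong_right) (auto simp: d_def)
    also have "\<dots> = card ({..<Suc n} - {j, p})" by simp
    also have "\<dots> = Suc n - card {j, p}"
      using j p by (subst card_Diff_subset) auto
    finally show ?thesis using p by simp
  qed
  ultimately have Q: "det M \<in> forms n (n - 1)" by simp
  have g: "geval y (det M) = det (mat (Suc n) (Suc n) (\<lambda>rk. geval y (c rk)))" for y
    by (subst geval.hom_det[symmetric]) (rule arg_cong[of _ _ det], auto simp: M_def)
  have pe: "peval y (det M) = det (mat (Suc n) (Suc n) (\<lambda>rk. peval y (c rk)))" for y
    by (subst peval.hom_det[symmetric]) (rule arg_cong[of _ _ det], auto simp: M_def)
  have const: "geval y (Poly_Mapping.single 0 e) = to_ac e"
    "peval w (Poly_Mapping.single 0 e) = e" for y w and e :: 'a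
    using geval_psmult[of y e 1] peval_psmult[of w e 1] by (simp_all add: psmult_def)
  show ?thesis
  proof
    show "det M \<in> forms n (n - 1)" by (rule Q)
    let ?e = "point n E (\<lambda>k. if k = j then 1 else 0)"
    \<comment> \<open>At the vertex all \<open>x\<^sub>r\<close> with \<open>r \<noteq> j\<close> vanish and \<open>f\<^sub>r\<close> takes the value \<open>a\<^sub>r\<^sub>j\<close>. So the rows of \<open>M\<close> other
      than row \<open>j\<close> are multiples of unit vectors, and the kernel is zero.\<close>
    show "peval ?e (det M) \<noteq> 0"
    proof
      assume "peval ?e (det M) = 0"
      then obtain v where v: "v \<in> carrier_vec (Suc n)" "v \<noteq> 0\<^sub>v (Suc n)"
        "mat (Suc n) (Suc n) (\<lambda>rk. peval ?e (c rk)) *\<^sub>v v = 0\<^sub>v (Suc n)"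
        unfolding pe det_0_iff_vec_prod_zero[OF mat_carrier] by blast
      have vv: "v = vec (Suc n) (\<lambda>k. v $ k)" using v(1) by auto
      have row: "(\<Sum>k\<le>n. peval ?e (c (r, k)) * v $ k) = 0" if "r \<le> n" for r
      proof -
        have "(mat (Suc n) (Suc n) (\<lambda>rk. peval ?e (c rk)) *\<^sub>v vec (Suc n) (\<lambda>k. v $ k)) $ r = 0"
          using v(3) vv that by simp
        then show ?thesis using that by (subst (asm) mult_mat_vec_nth) auto
      qed
      have "v $ r = 0" if r: "r \<le> n" "r \<noteq> j" for r
      proof (cases "r = p")
        case True
        have "(\<Sum>k\<le>n. peval ?e (c (r, k)) * v $ k) = (\<Sum>k\<le>n. if k = p then v $ k else 0)"
          by (rule sum.cong) (use r True in \<open>auto simp: c_def\<close>)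
        then show ?thesis using row[OF r(1)] p True by simp
      next
        case False
        have xr: "peval ?e (x r) = 0" using dual[OF r(1)] r by simp
        have fr: "peval ?e (f r) = a r j"
          using j by (simp add: f_def hom_distribs dual if_distrib[of "\<lambda>c. _ * c"] cong: if_cong)
        have "(\<Sum>k\<le>n. peval ?e (c (r, k)) * v $ k) = (\<Sum>k\<le>n. if k = r then a r j * v $ k else 0)"
          by (rule sum.cong) (use r False xr fr in \<open>auto simp: c_def hom_distribs\<close>)
        then have "a r j * v $ r = 0" using row[OF r(1)] r by simp
        then show ?thesis using a[OF r(1) j] r by simp
      qed
      note v0 = this
      have "(\<Sum>k\<le>n. peval ?e (c (j, k)) * v $ k) = (\<Sum>k\<le>n. if k = j then a p j * v $ k else 0)"
        by (rule sum.cong) (use v0 in \<open>auto simp: c_def const\<close>)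
      then have "a p j * v $ j = 0" using row[OF j] j by simp
      then have "v $ j = 0" using a[OF p(1) j] p by simp
      then have "v $ k = 0" if "k < Suc n" for k using v0[of k] that by (cases "k = j") auto
      then have "v = 0\<^sub>v (Suc n)" using v(1) by (intro eq_vecI) auto
      then show False using v(2) by simp
    qed
    fix i y
    assume i: "i \<le> n" "i \<noteq> j" and y: "y \<in> proj_points n"
      and xi: "geval y (x i) = 0" and fi: "geval y (f i) = 0"
    let ?N = "mat (Suc n) (Suc n) (\<lambda>rk. geval y (c rk))"
    \<comment> \<open>On \<open>\<Pi>\<^sub>p\<close> the coordinate vector is in the kernel: row \<open>j\<close> gives \<open>f\<^sub>p\<close>, row \<open>p\<close> gives \<open>x\<^sub>p\<close>, the others
      give zero anyway. On the other \<open>\<Pi>\<^sub>i\<close> row \<open>i\<close> is zero.\<close>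
    show "geval y (det M) = 0"
    proof (cases "i = p")
      case True
      let ?v = "vec (Suc n) (\<lambda>k. geval y (x k))"
      have "(\<Sum>k\<le>n. geval y (c (r, k)) * geval y (x k)) = 0" if r: "r \<le> n" for r
      proof -
        consider "r = j" | "r = p" "r \<noteq> j" | "r \<noteq> j" "r \<noteq> p" by blast
        then show ?thesis
        proof cases
          case 1
          then show ?thesis using fi True by (simp add: c_def const f_def hom_distribs)
        next
          case 2
          then show ?thesis using xi True by (auto simp: c_def intro!: sum.neutral)
        next
          case 3
          have "(\<Sum>k\<le>n. geval y (c (r, k)) * geval y (x k)) =
            (\<Sum>k\<le>n. (if k = r then geval y (f r) * geval y (x r) else 0)
              - geval y (x r) * (to_ac (a r k) * geval y (x k)))"
            by (rule sum.cong) (use 3 in \<open>auto simp: c_def hom_distribs algebra_simps\<close>)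
          also have "\<dots> = geval y (f r) * geval y (x r)
              - geval y (x r) * (\<Sum>k\<le>n. to_ac (a r k) * geval y (x k))"
            using r by (simp add: sum_subtractf sum_distrib_left)
          also have "\<dots> = 0" by (simp add: f_def hom_distribs mult.commute)
          finally show ?thesis .
        qed
      qed
      then have "(?N *\<^sub>v ?v) $ r = 0" if "r < Suc n" for r
        using that by (subst mult_mat_vec_nth) auto
      then have "?N *\<^sub>v ?v = 0\<^sub>v (Suc n)" by (intro eq_vecI) auto
      moreover have "?v \<noteq> 0\<^sub>v (Suc n)"
      proof
        assume v0: "?v = 0\<^sub>v (Suc n)"
        have 0: "geval y (x k) = 0" if "k \<le> n" for k
          using arg_cong[OF v0, of "\<lambda>v :: 'a alg_closure vec. v $ k"] that by simp
        have "y k = 0" if "k \<le> n" for k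
        proof -
          have "y k = geval y (var k)" by simp
          also have "\<dots> = 0"
            unfolding var_eq[OF that] by (simp add: hom_distribs 0)
          finally show ?thesis .
        qed
        then show False using y by (auto simp: proj_points_def)
      qed
      ultimately show ?thesis
        unfolding g det_0_iff_vec_prod_zero[OF mat_carrier] using vec_carrier by blast
    next
      case False
      have "(\<Prod>r<Suc n. ?N $$ (r, \<sigma> r)) = 0" if "\<sigma> permutes {..<Suc n}" for \<sigma>
      proof (rule prod_zero)
        have "\<sigma> i < Suc n" using permutes_in_image[OF that, of i] i by simp
        then have "?N $$ (i, \<sigma> i) = 0"
          using i False xi fi by (simp add: c_def hom_distribs)
        then show "\<exists>r\<in>{..<Suc n}. ?N $$ (r, \<sigma> r) = 0" using i by auto
      qed simp
      then show ?thesis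
        unfolding g det_def'[OF mat_carrier] atLeast0LessThan
        by (intro sum.neutral ballI) (simp only: mem_Collect_eq mult_zero_right)
    qed
  qed
qed

section \<open>Ideals of linear subspaces of codimension 2\<close>

lemma poly_ring_induct [consumes 1, case_names const var add mult]:
  fixes F :: "('v, 'a::field_char_0) mpoly"
  assumes F: "F \<in> poly_ring V"
    and const: "\<And>c. P (Poly_Mapping.single 0 c)" and var: "\<And>v. v \<in> V \<Longrightarrow> P (var v)"
    and add: "\<And>F G. F \<in> poly_ring V \<Longrightarrow> G \<in> poly_ring V \<Longrightarrow> P F \<Longrightarrow> P G \<Longrightarrow> P (F + G)"
    and mult: "\<And>F G. F \<in> poly_ring V \<Longrightarrow> G \<in> poly_ring V \<Longrightarrow> P F \<Longrightarrow> P G \<Longrightarrow> P (F * G)"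
  shows "P F"
proof -
  let ?P = "\<lambda>F. F \<in> poly_ring V \<and> P F"
  have one: "?P 1" using const[of 1] by simp
  have Pmult: "?P F \<Longrightarrow> ?P G \<Longrightarrow> ?P (F * G)" for F G
    using mult poly_ring_mult by blast
  have Padd: "?P F \<Longrightarrow> ?P G \<Longrightarrow> ?P (F + G)" for F G
    using add poly_ring_add by blast
  have Pvar: "?P (var v)" if "v \<in> V" for v using that var by simp
  have pow: "?P (var v ^ k)" if "v \<in> V" for v k
    by (induction k) (use one Pmult[OF Pvar[OF that]] in simp_all)
  have prod: "?P (\<Prod>v\<in>A. var v ^ k v)" if "finite A" "A \<subseteq> V" for A k
    using that
  proof (induction A rule: finite_induct)
    case (insert v A)
    then show ?case using Pmult[OF pow, of v "\<Prod>v\<in>A. var v ^ k v"] by simp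
  qed (use one in simp)
  have monomial: "?P (Poly_Mapping.single 0 c * monom_eval var m)"
    if "Poly_Mapping.keys m \<subseteq> V" for c m
    using const[of c] prod[OF _ that] unfolding monom_eval_def by (intro Pmult) simp_all
  have sum: "?P (\<Sum>m\<in>M. Poly_Mapping.single 0 (c m) * monom_eval var m)"
    if "finite M" "\<And>m. m \<in> M \<Longrightarrow> Poly_Mapping.keys m \<subseteq> V" for M c
    using that
  proof (induction M rule: finite_induct)
    case empty
    then show ?case using const[of 0] by simp
  next
    case (insert m M)
    then show ?case using Padd[OF monomial[of m "c m"]] by simp
  qed
  \<comment> \<open>Substituting every variable for itself writes \<open>F\<close> as a sum of products of constants and variables.\<close>
  have "F = psubst var F"
    by (rule mpoly_eqI) (simp add: peval_psubst)
  moreover have "?P (psubst var F)"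
    unfolding psubst_def heval_def by (rule sum) (use F in \<open>auto simp: poly_ring_def\<close>)
  ultimately show ?thesis by simp
qed

text \<open>
  In \<open>r = p x + q f\<close> only the constant terms of \<open>p\<close> and \<open>q\<close> contribute to degree 1. They are isolated
  by evaluating at \<open>t y\<close>, cancelling the common factor \<open>t\<close> and putting \<open>t = 0\<close>.
\<close>

lemma linear_form_in_ideal2:
  fixes x f r :: "(nat, 'a::field_char_0) mpoly"
  assumes "x \<in> forms n 1" "f \<in> forms n 1" "r \<in> forms n 1" "r \<in> ideal2 n x f"
  obtains c d where "r = psmult c x + psmult d f"
proof -
  obtain p q where r: "r = p * x + q * f"
    using assms(4) by (auto simp: ideal2_def)
  have "peval y r = peval (\<lambda>_. 0) p * peval y x + peval (\<lambda>_. 0) q * peval y f" for y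
  proof -
    obtain p' where p': "\<forall>t. poly p' t = peval (\<lambda>v. 0 + t * y v) p"
      using line_poly_peval[of p, unfolded line_poly_def, THEN spec, of "\<lambda>_. 0", THEN spec, of y]
      by (elim exE)
    obtain q' where q': "\<forall>t. poly q' t = peval (\<lambda>v. 0 + t * y v) q"
      using line_poly_peval[of q, unfolded line_poly_def, THEN spec, of "\<lambda>_. 0", THEN spec, of y]
      by (elim exE)
    let ?h = "[:0, 1:] * ([:peval y r:] - p' * [:peval y x:] - q' * [:peval y f:])"
    have "poly ?h t = 0" for t
    proof -
      have "peval (\<lambda>v. t * y v) r = peval (\<lambda>v. t * y v) p * peval (\<lambda>v. t * y v) x
          + peval (\<lambda>v. t * y v) q * peval (\<lambda>v. t * y v) f"
        by (simp add: r hom_distribs)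
      then show ?thesis
        using peval_form_scale[OF assms(1), of t y] peval_form_scale[OF assms(2), of t y]
          peval_form_scale[OF assms(3), of t y]
        by (simp add: p' q' algebra_simps)
    qed
    then have "?h = 0" using poly_all_0_iff_0 by blast
    then have "[:peval y r:] - p' * [:peval y x:] - q' * [:peval y f:] = 0" by simp
    then have "poly ([:peval y r:] - p' * [:peval y x:] - q' * [:peval y f:]) 0 = 0" by simp
    then show ?thesis using p'[THEN spec, of 0] q'[THEN spec, of 0] by (simp add: algebra_simps)
  qed
  then have "r = psmult (peval (\<lambda>_. 0) p) x + psmult (peval (\<lambda>_. 0) q) f"
    by (intro mpoly_eqI) (simp add: hom_distribs)
  then show ?thesis by (rule that)
qed

text \<open>
  A linear subspace is the zero locus of its ideal, and \<open>x, f\<close> generate this ideal.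
\<close>

lemma zero_locus_if_vanishing_ideal:
  assumes "\<Lambda> \<in> codim2_subspaces n" "vanishing_ideal n \<Lambda> = ideal2 n x f"
  shows "\<Lambda> = zero_locus n {x, f}"
proof -
  obtain l m where \<Lambda>: "\<Lambda> = zero_locus n {l, m}" and lm: "l \<in> forms n 1" "m \<in> forms n 1"
    using assms(1) unfolding codim2_subspaces_def by blast
  have "l \<in> vanishing_ideal n \<Lambda>" "m \<in> vanishing_ideal n \<Lambda>"
    using lm by (auto simp: vanishing_ideal_def vanishes_on_def \<Lambda> zero_locus_def forms_in_poly_ring)
  then have lm': "l \<in> ideal2 n x f" "m \<in> ideal2 n x f" using assms(2) by auto
  have "x = 1 * x + 0 * f" "f = 0 * x + 1 * f" by simp_all
  then have "x \<in> ideal2 n x f" "f \<in> ideal2 n x f"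
    unfolding ideal2_def using poly_ring_one poly_ring_zero by blast+
  then have "x \<in> vanishing_ideal n \<Lambda>" "f \<in> vanishing_ideal n \<Lambda>" using assms(2) by auto
  then have "\<Lambda> \<subseteq> zero_locus n {x, f}"
    by (auto simp: vanishing_ideal_def vanishes_on_def \<Lambda> zero_locus_def)
  moreover have "zero_locus n {x, f} \<subseteq> \<Lambda>"
    using lm' by (auto simp: \<Lambda> zero_locus_def ideal2_def hom_distribs)
  ultimately show ?thesis by blast
qed

context linear_coordinates
begin

text \<open>
  As \<open>a\<^sub>t \<noteq> 0\<close> for some \<open>t \<noteq> i\<close>, the equations \<open>x\<^sub>i = f = 0\<close> express \<open>x\<^sub>i\<close> and \<open>x\<^sub>t\<close> by the other
  coordinates. The corresponding substitution \<open>\<sigma>\<close> changes a polynomial only by an element of the ideal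
  \<open>(x\<^sub>i, f)\<close>, and maps every \<open>K\<close>-point to a solution of the equations. If \<open>F\<close> vanishes on the locus, then
  \<open>F(\<sigma>)\<close> is therefore zero at all points, except that \<open>\<sigma>\<close> may send a point to the origin. The
  latter does not happen where a third coordinate \<open>x\<^sub>u\<close>, which exists for \<open>n \<ge> 2\<close>, is nonzero. Thus
  \<open>x\<^sub>u F(\<sigma>) = 0\<close>, and \<open>F = F - F(\<sigma>)\<close> is in the ideal.
\<close>

lemma vanishing_ideal_of_locus:
  assumes n: "n \<ge> 2" and i: "i \<le> n"
    and a: "\<And>j. j \<le> n \<Longrightarrow> a j = 0 \<longleftrightarrow> i = j"
  defines "f \<equiv> \<Sum>j\<le>n. psmult (a j) (x j)"
  shows "vanishing_ideal n (zero_locus n {x i, f}) = ideal2 n (x i) f"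
proof
  have xp: "x j \<in> poly_ring {..n}" if "j \<le> n" for j
    using x_form[OF that] by (rule forms_in_poly_ring)
  have fp: "f \<in> poly_ring {..n}"
    unfolding f_def by (intro poly_ring_sum poly_ring_psmult xp) simp
  show "ideal2 n (x i) f \<subseteq> vanishing_ideal n (zero_locus n {x i, f})"
    using xp[OF i] fp
    by (auto simp: ideal2_def vanishing_ideal_def vanishes_on_def zero_locus_def hom_distribs
        intro!: poly_ring_add poly_ring_mult)
  obtain t where t: "t \<le> n" "t \<noteq> i"
    using n that[of 0] that[of 1] by (cases "i = 0") auto
  obtain u where u: "u \<le> n" "u \<noteq> i" "u \<noteq> t"
  proof -
    have "card {..n} > card {i, t}" using n t by simp
    then have "\<not> {..n} \<subseteq> {i, t}" using card_mono[of "{i, t}" "{..n}"] by auto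
    then show ?thesis using that by blast
  qed
  have at: "a t \<noteq> 0" using a[OF t(1)] t(2) by simp
  let ?R = "{..n} - {i, t}"
  have split: "(\<Sum>j\<le>n. g j) = (\<Sum>j\<in>?R. g j) + g i + g t"
    for g :: "nat \<Rightarrow> 'b::comm_monoid_add"
    using sum.subset_diff[of "{i, t}" "{..n}" g] i t by (simp add: add.assoc)
  define \<sigma> where "\<sigma> k = (if k \<le> n then
    \<Sum>j\<in>?R. psmult (E k j - E k t * a j / a t) (x j) else 0)" for k
  have \<sigma>p: "\<sigma> k \<in> poly_ring {..n}" for k
    unfolding \<sigma>_def by (auto intro!: poly_ring_sum poly_ring_psmult xp)
  have \<sigma>_ideal: "var k - \<sigma> k = psmult (E k i) (x i) + psmult (E k t / a t) f" if k: "k \<le> n" for k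
  proof -
    have "f = (\<Sum>j\<in>?R. psmult (a j) (x j)) + psmult (a t) (x t)"
      unfolding f_def split using a[OF i] by simp
    then have "psmult (E k t / a t) f =
        (\<Sum>j\<in>?R. psmult (E k t * a j / a t) (x j)) + psmult (E k t) (x t)"
      using at by (simp add: mpoly.scale_right_distrib mpoly.scale_sum_right)
    then show ?thesis
      unfolding var_eq[OF k] split \<sigma>_def using k
      by (simp add: mpoly.scale_left_diff_distrib sum_subtractf)
  qed
  have ideal: "F - psubst \<sigma> F \<in> ideal2 n (x i) f \<and> psubst \<sigma> F \<in> poly_ring {..n}"
    if "F \<in> poly_ring {..n}" for F
    using that
  proof (induction rule: poly_ring_induct)
    case (const c)
    have "psubst \<sigma> (Poly_Mapping.single 0 c) = Poly_Mapping.single 0 c"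
      by (simp add: psubst_def comm_ring_hom.heval_single[OF comm_ring_hom_const])
    moreover have "0 = 0 * x i + 0 * f" by simp
    then have "0 \<in> ideal2 n (x i) f" unfolding ideal2_def using poly_ring_zero by blast
    ultimately show ?case by simp
  next
    case (var k)
    have "psubst \<sigma> (var k) = \<sigma> k"
      by (rule mpoly_eqI) (simp add: peval_psubst)
    moreover have "var k - \<sigma> k \<in> ideal2 n (x i) f"
      unfolding ideal2_def psmult_def \<sigma>_ideal[OF var[unfolded atMost_iff]]
      using poly_ring_const by blast
    ultimately show ?case using \<sigma>p by simp
  next
    case (add F G)
    then obtain p q p' q' where FG: "F - psubst \<sigma> F = p * x i + q * f" "G - psubst \<sigma> G = p' * x i + q' * f"
      and P: "p \<in> poly_ring {..n}" "q \<in> poly_ring {..n}" "p' \<in> poly_ring {..n}" "q' \<in> poly_ring {..n}"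
      unfolding ideal2_def by blast
    have "(F + G) - psubst \<sigma> (F + G) = (F - psubst \<sigma> F) + (G - psubst \<sigma> G)"
      by (simp add: hom_distribs)
    also have "\<dots> = (p + p') * x i + (q + q') * f"
      unfolding FG by (simp add: algebra_simps)
    finally have "(F + G) - psubst \<sigma> (F + G) \<in> ideal2 n (x i) f"
      unfolding ideal2_def using P poly_ring_add by blast
    then show ?case using add by (simp add: hom_distribs poly_ring_add)
  next
    case (mult F G)
    then obtain p q p' q' where FG: "F - psubst \<sigma> F = p * x i + q * f" "G - psubst \<sigma> G = p' * x i + q' * f"
      and P: "p \<in> poly_ring {..n}" "q \<in> poly_ring {..n}" "p' \<in> poly_ring {..n}" "q' \<in> poly_ring {..n}"
      unfolding ideal2_def by blast
    have "(F * G) - psubst \<sigma> (F * G) = F * (G - psubst \<sigma> G) + psubst \<sigma> G * (F - psubst \<sigma> F)"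
      by (simp add: hom_distribs algebra_simps)
    also have "\<dots> = (F * p' + psubst \<sigma> G * p) * x i + (F * q' + psubst \<sigma> G * q) * f"
      unfolding FG by (simp add: algebra_simps)
    finally have eq: "(F * G) - psubst \<sigma> (F * G) =
      (F * p' + psubst \<sigma> G * p) * x i + (F * q' + psubst \<sigma> G * q) * f" .
    have "F * p' + psubst \<sigma> G * p \<in> poly_ring {..n}" "F * q' + psubst \<sigma> G * q \<in> poly_ring {..n}"
      using P mult by (auto intro!: poly_ring_add poly_ring_mult)
    then have "(F * G) - psubst \<sigma> (F * G) \<in> ideal2 n (x i) f"
      unfolding ideal2_def eq by blast
    then show ?case using mult by (simp add: hom_distribs poly_ring_mult)
  qed
  show "vanishing_ideal n (zero_locus n {x i, f}) \<subseteq> ideal2 n (x i) f"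
  proof
    fix F
    assume F: "F \<in> vanishing_ideal n (zero_locus n {x i, f})"
    have "peval y (x u) * peval y (psubst \<sigma> F) = 0" for y
    proof (cases "peval y (x u) = 0")
      case False
      define w where "w j = (if j = i then 0 else if j = t then
        - (\<Sum>j\<in>?R. a j * peval y (x j)) / a t else peval y (x j))" for j
      have w: "w i = 0" "w t = - (\<Sum>j\<in>?R. a j * peval y (x j)) / a t" "w u = peval y (x u)"
        using t u by (auto simp: w_def)
      have wR: "w j = peval y (x j)" if "j \<in> ?R" for j using that by (simp add: w_def)
      have \<sigma>_point: "peval y (\<sigma> k) = point n E w k" for k
      proof (cases "k \<le> n")
        case True
        then have "point n E w k = (\<Sum>j\<in>?R. E k j * peval y (x j)) + E k t * w t"
          by (simp add: point_def split w(1) wR)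
        then show ?thesis
          using True by (simp add: \<sigma>_def hom_distribs w(2) left_diff_distrib right_diff_distrib sum_subtractf
              sum_distrib_left sum_divide_distrib mult_ac)
      qed (simp add: \<sigma>_def point_def)
      have "peval (point n E w) (x i) = 0" using dual[OF i] w by simp
      moreover have "peval (point n E w) f = 0"
      proof -
        have "peval (point n E w) f = (\<Sum>j\<le>n. a j * w j)"
          by (simp add: f_def hom_distribs dual)
        also have "\<dots> = 0" unfolding split using at by (simp add: w wR)
        finally show ?thesis .
      qed
      moreover have "\<exists>k\<le>n. point n E w k \<noteq> 0"
        using nonzero_point[OF u(1)] False w(3) by simp
      moreover have "\<forall>k>n. point n E w k = 0" by (simp add: point_def)
      ultimately have "(\<lambda>v. to_ac (point n E w v)) \<in> zero_locus n {x i, f}"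
        by (auto simp: zero_locus_def proj_points_def geval_to_ac)
      then have "geval (\<lambda>v. to_ac (point n E w v)) F = 0"
        using F by (auto simp: vanishing_ideal_def vanishes_on_def)
      then have "peval (point n E w) F = 0" by (simp add: geval_to_ac)
      then show ?thesis by (simp add: peval_psubst \<sigma>_point)
    qed simp
    then have "x u * psubst \<sigma> F = 0"
      by (intro mpoly_eq_zero_if_peval_zero) (simp add: peval.hom_mult)
    then have "psubst \<sigma> F = 0" using x_nonzero[OF u(1)] by simp
    then show "F \<in> ideal2 n (x i) f"
      using ideal[of F] F by (simp add: vanishing_ideal_def)
  qed
qed

end

section \<open>The linear system in adapted coordinates\<close>

locale adapted_coordinates = linear_coordinates n x E
  for n and x :: "nat \<Rightarrow> (nat, 'a::field_char_0) mpoly" and E +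
  fixes a :: "nat \<Rightarrow> nat \<Rightarrow> 'a" and \<Lambda> :: "nat \<Rightarrow> (nat \<Rightarrow> 'a alg_closure) set"
  assumes n_ge_2: "n \<ge> 2"
    and a_eq_0_iff: "\<And>i j. i \<le> n \<Longrightarrow> j \<le> n \<Longrightarrow> a i j = 0 \<longleftrightarrow> i = j"
    and locus: "\<And>i. i \<le> n \<Longrightarrow> \<Lambda> i = zero_locus n {x i, \<Sum>j\<le>n. psmult (a i j) (x j)}"

lemma adapted_coordinates_exist:
  fixes x :: "nat \<Rightarrow> (nat, 'a::field_char_0) mpoly"
  assumes "n \<ge> 2" "\<Lambda> \<in> params n" "adapted_coords n \<Lambda> x a"
  obtains E where "adapted_coordinates n x E a \<Lambda>"
proof -
  obtain E where E: "linear_coordinates n x E"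
    using linear_coordinates_exist[of n x] assms(3) unfolding adapted_coords_def by metis
  have "\<Lambda> i = zero_locus n {x i, \<Sum>j\<le>n. psmult (a i j) (x j)}" if "i \<le> n" for i
  proof (rule zero_locus_if_vanishing_ideal)
    show "\<Lambda> i \<in> codim2_subspaces n" using assms(2) that by (auto simp: params_def)
    show "vanishing_ideal n (\<Lambda> i) = ideal2 n (x i) (\<Sum>j\<le>n. psmult (a i j) (x j))"
      using assms(3) that by (auto simp: adapted_coords_def)
  qed
  then have "adapted_coordinates n x E a \<Lambda>"
    using E assms by (intro adapted_coordinates.intro adapted_coordinates_axioms.intro)
      (auto simp: adapted_coords_def)
  then show ?thesis by (rule that)
qed

lemma subspace_lin_system: "mpoly.subspace (lin_system n \<Lambda>)"
proof (intro mpoly.subspaceI)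
  show "0 \<in> lin_system n \<Lambda>" by (simp add: lin_system_def vanishes_on_def)
next
  fix F G
  assume "F \<in> lin_system n \<Lambda>" "G \<in> lin_system n \<Lambda>"
  then show "F + G \<in> lin_system n \<Lambda>"
    by (auto simp: lin_system_def vanishes_on_def hom_distribs intro: forms_add)
next
  fix c F
  assume "F \<in> lin_system n \<Lambda>"
  then show "psmult c F \<in> lin_system n \<Lambda>"
    by (auto simp: lin_system_def vanishes_on_def intro: forms_psmult)
qed

context adapted_coordinates
begin

lemma adapted: "adapted_coords n \<Lambda> x a"
  unfolding adapted_coords_def
  using basis a_eq_0_iff vanishing_ideal_of_locus[OF n_ge_2] locus by auto

lemma Q_form_exists:
  assumes "j \<le> n"
  shows "\<exists>Q\<in>Q_forms n \<Lambda> j. peval (vertex j) Q \<noteq> 0"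
proof -
  obtain Q where Q: "Q \<in> forms n (n - 1)" "peval (vertex j) Q \<noteq> 0"
    and van: "\<And>i y. i \<le> n \<Longrightarrow> i \<noteq> j \<Longrightarrow> y \<in> proj_points n \<Longrightarrow>
      geval y (x i) = 0 \<Longrightarrow> geval y (\<Sum>k\<le>n. psmult (a i k) (x k)) = 0 \<Longrightarrow> geval y Q = 0"
    using determinantal_hypersurface[of a j] a_eq_0_iff n_ge_2 assms by auto
  have "vanishes_on Q (\<Lambda> i)" if "i \<le> n" "i \<noteq> j" for i
    using van[OF that] by (auto simp: vanishes_on_def locus[OF that(1)] zero_locus_def)
  then have "Q \<in> Q_forms n \<Lambda> j" using Q by (auto simp: Q_forms_def)
  then show ?thesis using Q by blast
qed

lemma x_mult_in_lin_system:
  assumes i: "i \<le> n" and "Q \<in> forms n (n - 1)" "\<And>k. k \<le> n \<Longrightarrow> k \<noteq> i \<Longrightarrow> vanishes_on Q (\<Lambda> k)"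
  shows "x i * Q \<in> lin_system n \<Lambda>"
proof -
  have "x i * Q \<in> forms n (1 + (n - 1))" by (rule forms_mult[OF x_form[OF i] assms(2)])
  moreover have "geval y (x i * Q) = 0" if "k \<le> n" "y \<in> \<Lambda> k" for k y
    using assms(3)[OF that(1)] that locus[OF i]
    by (cases "k = i") (auto simp: hom_distribs vanishes_on_def zero_locus_def)
  ultimately show ?thesis using n_ge_2 by (auto simp: lin_system_def vanishes_on_def)
qed

text \<open>
  The second case is the origin, which represents no projective point; there a form of positive degree
  vanishes for trivial reasons.
\<close>

lemma peval_zero_on_locus:
  assumes F: "F \<in> forms n d" "d > 0" "vanishes_on F (\<Lambda> i)" and i: "i \<le> n"
    and w: "w i = 0" "(\<Sum>j\<le>n. a i j * w j) = 0"
  shows "peval (point n E w) F = 0"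
proof (cases "\<exists>k\<le>n. point n E w k \<noteq> 0")
  case True
  have "\<forall>k>n. point n E w k = 0" by (simp add: point_def)
  moreover have "peval (point n E w) (x i) = 0"
    "peval (point n E w) (\<Sum>j\<le>n. psmult (a i j) (x j)) = 0"
    using w dual i by (simp_all add: hom_distribs)
  ultimately have "(\<lambda>v. to_ac (point n E w v)) \<in> \<Lambda> i"
    using True by (auto simp: locus[OF i] zero_locus_def proj_points_def geval_to_ac)
  then have "geval (\<lambda>v. to_ac (point n E w v)) F = 0"
    using F(3) by (auto simp: vanishes_on_def)
  then show ?thesis by (simp add: geval_to_ac)
next
  case False
  then have "point n E w = (\<lambda>v. 0 * point n E w v)" by (auto simp: point_def fun_eq_iff)
  then have "peval (point n E w) F = 0 ^ d * peval (point n E w) F"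
    using peval_form_scale[OF F(1), of 0 "point n E w"] by simp
  then show ?thesis using F(2) by (simp add: zero_power)
qed

lemma peval_vertex_product:
  assumes "i \<le> n" "k \<le> n"
  shows "peval (vertex k) (x i * Q) = (if i = k then peval (vertex k) Q else 0)"
  using dual[OF assms(1)] by (simp add: hom_distribs)

lemma products_independent:
  assumes "\<And>i. i \<le> n \<Longrightarrow> peval (vertex i) (Q i) \<noteq> 0"
  shows "indep_family {..n} (\<lambda>i. x i * Q i)"
  unfolding indep_family_def
proof (intro allI impI ballI)
  fix c k
  assume 0: "(\<Sum>i\<le>n. psmult (c i) (x i * Q i)) = 0" and k: "k \<in> {..n}"
  have "(\<Sum>i\<le>n. c i * peval (vertex k) (x i * Q i)) = 0"
    using arg_cong[OF 0, of "peval (vertex k)"] unfolding peval.hom_sum peval_psmult by simp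
  moreover have "(\<Sum>i\<le>n. c i * peval (vertex k) (x i * Q i)) =
      (\<Sum>i\<le>n. if i = k then c k * peval (vertex k) (Q k) else 0)"
    by (rule sum.cong) (use k peval_vertex_product in auto)
  ultimately have "c k * peval (vertex k) (Q k) = 0" using k by simp
  then show "c k = 0" using assms[of k] k by simp
qed

end

text \<open>
  It is enough that the minors are nonzero for one choice of adapted coordinates: uniqueness of the
  \<open>Q\<^sub>j\<close> and the dimension of the linear system, which are derived from it, do not refer to coordinates.
\<close>

locale general_coordinates = adapted_coordinates +
  assumes minors: "minors_nonzero n a"
begin

lemma lin_system_eq_zeroI:
  assumes F: "F \<in> lin_system n \<Lambda>" and 0: "\<And>k. k \<le> n \<Longrightarrow> peval (vertex k) F = 0"
  shows "F = 0"
proof (rule mpoly_eq_zero_if_peval_zero)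
  fix y
  have Ff: "F \<in> forms n n" and van: "vanishes_on F (\<Lambda> i)" if "i \<le> n" for i
    using F that by (auto simp: lin_system_def vanishes_on_def)
  then have Ff: "F \<in> forms n n" by blast
  have "peval (point n E w) F = 0" for w
  proof (rule form_vanishes_if_at_coordinate_points[where a = a and n = n
        and \<phi> = "\<lambda>w. peval (point n E w) F"])
    fix w u
    show "\<exists>q. degree q \<le> n \<and> (\<forall>t. poly q t = peval (point n E (\<lambda>k. w k + t * u k)) F)"
      using peval_form_on_line[OF Ff, of "point n E w" "point n E u"] unfolding point_line by metis
  next
    fix i w
    assume "i \<le> n" "w i = 0" "(\<Sum>j\<le>n. a i j * w j) = 0"
    then show "peval (point n E w) F = 0"
      using peval_zero_on_locus[OF Ff _ van] n_ge_2 by simp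
  next
    fix k and w :: "nat \<Rightarrow> 'a"
    assume k: "k \<le> n" and w: "\<And>j. j \<le> n \<Longrightarrow> j \<noteq> k \<Longrightarrow> w j = 0"
    have "point n E w = (\<lambda>v. w k * vertex k v)"
    proof
      fix v
      have "(\<Sum>l\<le>n. E v l * w l) = (\<Sum>l\<le>n. w k * (E v l * (if l = k then 1 else 0)))"
        by (rule sum.cong) (use w in auto)
      then show "point n E w v = w k * vertex k v"
        by (simp add: point_def sum_distrib_left)
    qed
    then have "peval (point n E w) F = w k ^ n * peval (vertex k) F"
      using peval_form_scale[OF Ff, of "w k" "vertex k"] by simp
    then show "peval (point n E w) F = 0" using 0[OF k] by simp
  qed (use a_eq_0_iff minors in auto)
  then show "peval y F = 0"
    using peval_at_own_coordinates[of F y] forms_in_poly_ring[OF Ff] by simp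
qed

text \<open>
  The product \<open>x\<^sub>j D\<close> is in the linear system and vanishes at every vertex: at \<open>e\<^sub>j\<close> because of \<open>D\<close>, at
  the others because of \<open>x\<^sub>j\<close>.
\<close>

lemma form_eq_zeroI:
  assumes j: "j \<le> n" and D: "D \<in> forms n (n - 1)" "\<And>i. i \<le> n \<Longrightarrow> i \<noteq> j \<Longrightarrow> vanishes_on D (\<Lambda> i)"
    and 0: "peval (vertex j) D = 0"
  shows "D = 0"
proof -
  have "x j * D = 0"
    by (rule lin_system_eq_zeroI) (use x_mult_in_lin_system[OF j D] peval_vertex_product[OF j] 0 in auto)
  then show ?thesis using x_nonzero[OF j] by simp
qed

lemma Q_form_at_vertex: "j \<le> n \<Longrightarrow> Q \<in> Q_forms n \<Lambda> j \<Longrightarrow> peval (vertex j) Q \<noteq> 0"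
  using form_eq_zeroI[of j Q] by (auto simp: Q_forms_def)

text \<open>The combination of the two forms that vanishes at the vertex \<open>e\<^sub>j\<close> is zero.\<close>

lemma Q_form_unique:
  assumes j: "j \<le> n" and F: "F \<in> Q_forms n \<Lambda> j" and G: "G \<in> Q_forms n \<Lambda> j"
  obtains c where "c \<noteq> 0" "G = psmult c F"
proof
  let ?f = "peval (vertex j) F" and ?g = "peval (vertex j) G"
  have nz: "?f \<noteq> 0" "?g \<noteq> 0" using Q_form_at_vertex j F G by blast+
  show "?g / ?f \<noteq> 0" using nz by simp
  have "G - psmult (?g / ?f) F = 0"
  proof (rule form_eq_zeroI[OF j])
    show "G - psmult (?g / ?f) F \<in> forms n (n - 1)"
      using F G by (auto simp: Q_forms_def intro: forms_diff forms_psmult)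
    show "vanishes_on (G - psmult (?g / ?f) F) (\<Lambda> i)" if "i \<le> n" "i \<noteq> j" for i
      using F G that by (auto simp: Q_forms_def vanishes_on_def hom_distribs)
    show "peval (vertex j) (G - psmult (?g / ?f) F) = 0"
      using nz by (simp add: hom_distribs)
  qed
  then show "G = psmult (?g / ?f) F" by simp
qed

lemma hypersurface_unique:
  assumes j: "j \<le> n"
  shows "\<exists>!H. H \<in> hypersurface ` Q_forms n \<Lambda> j"
proof -
  obtain F where F: "F \<in> Q_forms n \<Lambda> j" using Q_form_exists[OF j] by blast
  have "hypersurface G = hypersurface F" if G: "G \<in> Q_forms n \<Lambda> j" for G
  proof -
    obtain c where c: "c \<noteq> 0" "G = psmult c F" using Q_form_unique[OF j F G] .
    have 1: "psmult e G = psmult (e * c) F" and 2: "psmult e F = psmult (e / c) G" for e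
      using c by simp_all
    show ?thesis
      unfolding hypersurface_def
    proof safe
      fix e :: 'a
      assume "e \<noteq> 0"
      then show "\<exists>d. psmult e G = psmult d F \<and> d \<noteq> 0"
        using c(1) by (intro exI[of _ "e * c"] conjI 1) simp
      show "\<exists>d. psmult e F = psmult d G \<and> d \<noteq> 0"
        using c(1) \<open>e \<noteq> 0\<close> by (intro exI[of _ "e / c"] conjI 2) simp
    qed
  qed
  then show ?thesis using F by blast
qed

text \<open>
  Since \<open>x\<^sub>i Q\<^sub>i\<close> vanishes at all vertices except \<open>e\<^sub>i\<close>, some combination of these products takes the
  same values at the vertices as a given element of the linear system, and so equals it.
\<close>

lemma products_basis:
  assumes Q: "\<And>i. i \<le> n \<Longrightarrow> Q i \<in> Q_forms n \<Lambda> i"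
  shows "basis_family {..n} (\<lambda>i. x i * Q i) (lin_system n \<Lambda>)"
  unfolding basis_family_iff[OF finite_atMost]
proof
  let ?s = "\<lambda>i. x i * Q i"
  have nz: "peval (vertex i) (Q i) \<noteq> 0" if "i \<le> n" for i
    using Q_form_at_vertex Q that by blast
  show "indep_family {..n} ?s" by (rule products_independent) (rule nz)
  have sL: "?s i \<in> lin_system n \<Lambda>" if "i \<le> n" for i
    using x_mult_in_lin_system[OF that] Q[OF that] by (auto simp: Q_forms_def)
  have sub: "(\<Sum>i\<le>n. psmult (c i) (?s i)) \<in> lin_system n \<Lambda>" for c
    using sL subspace_lin_system[of n \<Lambda>]
    by (auto intro!: mpoly.subspace_sum mpoly.subspace_scale)
  have "F \<in> range (\<lambda>c. \<Sum>i\<le>n. psmult (c i) (?s i))" if F: "F \<in> lin_system n \<Lambda>" for F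
  proof -
    define c where "c i = peval (vertex i) F / peval (vertex i) (Q i)" for i
    have "F - (\<Sum>i\<le>n. psmult (c i) (?s i)) = 0"
    proof (rule lin_system_eq_zeroI)
      show "F - (\<Sum>i\<le>n. psmult (c i) (?s i)) \<in> lin_system n \<Lambda>"
        using F sub mpoly.subspace_diff[OF subspace_lin_system] by blast
      fix k
      assume k: "k \<le> n"
      have "(\<Sum>i\<le>n. c i * peval (vertex k) (?s i)) = (\<Sum>i\<le>n. if i = k then peval (vertex k) F else 0)"
        by (rule sum.cong) (use k peval_vertex_product nz in \<open>auto simp: c_def\<close>)
      then show "peval (vertex k) (F - (\<Sum>i\<le>n. psmult (c i) (?s i))) = 0"
        using k unfolding peval.hom_minus peval.hom_sum peval_psmult by simp
    qed
    then show ?thesis by simp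
  qed
  then show "lin_system n \<Lambda> = range (\<lambda>c. \<Sum>i\<le>n. psmult (c i) (?s i))"
    using sub by blast
qed

lemma dim_lin_system: "mpoly.dim (lin_system n \<Lambda>) = n + 1"
proof -
  have "\<forall>i. \<exists>Q. i \<le> n \<longrightarrow> Q \<in> Q_forms n \<Lambda> i" using Q_form_exists by blast
  from choice[OF this] obtain Q where "\<And>i. i \<le> n \<Longrightarrow> Q i \<in> Q_forms n \<Lambda> i" by blast
  then have b: "basis_family {..n} (\<lambda>i. x i * Q i) (lin_system n \<Lambda>)" by (rule products_basis)
  then show ?thesis
    using mpoly.dim_span_eq_card_independent[of "(\<lambda>i. x i * Q i) ` {..n}"]
      card_image[of "\<lambda>i. x i * Q i" "{..n}"] by (simp add: basis_family_def)
qed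

text \<open>
  The values of \<open>s\<^sub>0, \<dots>, s\<^sub>n\<close> at the vertices form a matrix \<open>S\<close> over \<open>K\<close>. Its kernel is zero over \<open>K\<close>,
  because a combination of the \<open>s\<^sub>i\<close> that vanishes at the vertices is zero. So \<open>det S \<noteq> 0\<close>, and the
  kernel is also zero over the algebraic closure, in which the coefficients \<open>c\<close> of a hyperplane lie.
\<close>

lemma image_not_in_hyperplane:
  assumes s: "basis_family {..n} s (lin_system n \<Lambda>)" and H: "H \<in> hyperplanes n"
  shows "\<not> rational_image n n s \<subseteq> H"
proof
  assume sub: "rational_image n n s \<subseteq> H"
  obtain c i0 where H: "H = {z \<in> proj_points n. (\<Sum>i\<le>n. c i * z i) = 0}" and c: "i0 \<le> n" "c i0 \<noteq> 0"
    using H unfolding hyperplanes_def by blast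
  have ind: "indep_family {..n} s" and L: "lin_system n \<Lambda> = range (\<lambda>c. \<Sum>i\<le>n. psmult (c i) (s i))"
    using s by (simp_all add: basis_family_iff)
  define S where "S = mat (Suc n) (Suc n) (\<lambda>(k, i). peval (vertex k) (s i))"
  have "det S \<noteq> 0"
  proof
    assume "det S = 0"
    then obtain v where v: "v \<in> carrier_vec (Suc n)" "v \<noteq> 0\<^sub>v (Suc n)" "S *\<^sub>v v = 0\<^sub>v (Suc n)"
      unfolding S_def det_0_iff_vec_prod_zero[OF mat_carrier] by blast
    have vv: "v = vec (Suc n) (\<lambda>k. v $ k)" using v(1) by auto
    have row: "(\<Sum>i\<le>n. peval (vertex k) (s i) * v $ i) = 0" if "k \<le> n" for k
    proof -
      have "(S *\<^sub>v vec (Suc n) (\<lambda>k. v $ k)) $ k = 0"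
        using v(3) vv that by simp
      then show ?thesis using that unfolding S_def by (subst (asm) mult_mat_vec_nth) auto
    qed
    have "(\<Sum>i\<le>n. psmult (v $ i) (s i)) = 0"
    proof (rule lin_system_eq_zeroI)
      show "(\<Sum>i\<le>n. psmult (v $ i) (s i)) \<in> lin_system n \<Lambda>" unfolding L by (rule rangeI)
      show "peval (vertex k) (\<Sum>i\<le>n. psmult (v $ i) (s i)) = 0" if "k \<le> n" for k
        using row[OF that] by (simp add: hom_distribs mult.commute)
    qed
    then have "v $ i = 0" if "i \<le> n" for i
      using ind[unfolded indep_family_def, THEN spec, of "\<lambda>i. v $ i"] that by auto
    then have "v = 0\<^sub>v (Suc n)" using v(1) by (intro eq_vecI) auto
    then show False using v(2) by simp
  qed
  have row: "(\<Sum>i\<le>n. to_ac (peval (vertex k) (s i)) * c i) = 0" if k: "k \<le> n" for k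
  proof -
    define z where "z i = (if i \<le> n then to_ac (peval (vertex k) (s i)) else 0)" for i
    \<comment> \<open>If all \<open>s\<^sub>i\<close> vanish at the vertex, it has no image, but then the relation holds trivially.\<close>
    have "(\<Sum>i\<le>n. c i * z i) = 0"
    proof (cases "\<exists>i\<le>n. z i \<noteq> 0")
      case True
      then have "z \<in> proj_points n" by (auto simp: proj_points_def z_def)
      moreover have "(\<lambda>v. to_ac (vertex k v)) \<in> proj_points n"
        using nonzero_point[OF k, of "\<lambda>i. if i = k then 1 else 0"]
        by (auto simp: proj_points_def) (simp_all add: point_def)
      moreover have "\<forall>i\<le>n. z i = 1 * geval (\<lambda>v. to_ac (vertex k v)) (s i)"
        by (simp add: z_def geval_to_ac)
      ultimately have "z \<in> rational_image n n s"
        unfolding rational_image_def using one_neq_zero by blast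
      then show ?thesis using sub H by auto
    next
      case False
      then show ?thesis by (intro sum.neutral) auto
    qed
    then show ?thesis by (simp add: z_def mult.commute)
  qed
  have map: "map_mat to_ac S = mat (Suc n) (Suc n) (\<lambda>(k, i). to_ac (peval (vertex k) (s i)))"
    by (auto simp: S_def)
  have "map_mat to_ac S *\<^sub>v vec (Suc n) c = 0\<^sub>v (Suc n)"
  proof (rule eq_vecI)
    fix k
    assume "k < dim_vec (0\<^sub>v (Suc n) :: 'a alg_closure vec)"
    then show "(map_mat to_ac S *\<^sub>v vec (Suc n) c) $ k = 0\<^sub>v (Suc n) $ k"
      unfolding map using row by (subst mult_mat_vec_nth) auto
  qed (simp add: map)
  moreover have "vec (Suc n) c \<noteq> 0\<^sub>v (Suc n)"
  proof
    assume "vec (Suc n) c = 0\<^sub>v (Suc n)"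
    then have "vec (Suc n) c $ i0 = 0\<^sub>v (Suc n) $ i0" by simp
    then show False using c by simp
  qed
  ultimately have "det (map_mat to_ac S) = 0"
    unfolding map det_0_iff_vec_prod_zero[OF mat_carrier] using vec_carrier by blast
  then show False
    using \<open>det S \<noteq> 0\<close> by (simp add: comm_ring_hom.hom_det[OF comm_ring_hom_to_ac])
qed

text \<open>
  The other coordinates \<open>x'\<close> come without a condition on minors. Independence only needs that \<open>Q\<^sub>i\<close> is
  nonzero at the \<open>i\<close>-th vertex of \<open>x'\<close>: this holds for the determinantal form of \<open>x'\<close>, which is
  proportional to \<open>Q\<^sub>i\<close> by uniqueness. Spanning follows from the dimension.
\<close>

lemma products_basis_any_coordinates:
  assumes x': "adapted_coordinates n x' E' a' \<Lambda>" and Q: "\<And>i. i \<le> n \<Longrightarrow> Q i \<in> Q_forms n \<Lambda> i"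
  shows "basis_family {..n} (\<lambda>i. x' i * Q i) (lin_system n \<Lambda>)"
proof (rule basis_familyI_card[OF products_basis[OF Q]])
  interpret x': adapted_coordinates n x' E' a' \<Lambda> by (rule x')
  show "indep_family {..n} (\<lambda>i. x' i * Q i)"
  proof (rule x'.products_independent)
    fix i
    assume i: "i \<le> n"
    obtain F where F: "F \<in> Q_forms n \<Lambda> i" "peval (x'.vertex i) F \<noteq> 0"
      using x'.Q_form_exists[OF i] by blast
    then show "peval (x'.vertex i) (Q i) \<noteq> 0"
      using Q_form_unique[OF i F(1) Q[OF i]] by (metis mult_eq_0_iff peval_psmult)
  qed
  show "x' i * Q i \<in> lin_system n \<Lambda>" if "i \<in> {..n}" for i
    using x'.x_mult_in_lin_system[of i "Q i"] Q[of i] that by (auto simp: Q_forms_def)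
qed auto

end

section \<open>The genericity condition as a polynomial\<close>

definition minor_indices :: "nat \<Rightarrow> (nat \<times> nat \<times> nat \<times> nat) set" where
  "minor_indices n = {(i, j, k, l) \<in> {..n} \<times> {..n} \<times> {..n} \<times> {..n}.
     i \<noteq> j \<and> k \<noteq> l \<and> k \<notin> {i, j} \<and> l \<notin> {i, j}}"

lemma finite_minor_indices [simp]: "finite (minor_indices n)"
  by (rule finite_subset[of _ "{..n} \<times> {..n} \<times> {..n} \<times> {..n}"]) (auto simp: minor_indices_def)

definition row_mat :: "nat \<Rightarrow> (nat \<times> nat \<times> nat \<Rightarrow> 'a) \<Rightarrow> nat \<Rightarrow> 'a mat" where
  "row_mat n C e = mat (Suc n) (Suc n) (\<lambda>(i, j). C (i, e, j))"

text \<open>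
  Let the rows of \<open>X = row_mat n C 0\<close> be the coefficients of linear forms \<open>x\<^sub>i\<close>, and those of
  \<open>G = row_mat n C 1\<close> the coefficients of \<open>g\<^sub>i = \<Sum>\<^sub>j c\<^sub>i\<^sub>j x\<^sub>j\<close>, that is, \<open>G = c X\<close>. Then
  \<open>G adj(X) = det(X) c\<close>, so this matrix is \<open>c\<close> up to a scalar and polynomial in \<open>C\<close>.
\<close>

definition scaled_coeffs :: "nat \<Rightarrow> (nat \<times> nat \<times> nat \<Rightarrow> 'a::comm_ring_1) \<Rightarrow> 'a mat" where
  "scaled_coeffs n C = row_mat n C 1 * adj_mat (row_mat n C 0)"

text \<open>
  Non-vanishing means that the \<open>x\<^sub>i\<close> form a basis and \<open>c\<close> is as required off the diagonal. The
  diagonal is left free because \<open>f\<^sub>i\<close> will be \<open>g\<^sub>i - c\<^sub>i\<^sub>i x\<^sub>i\<close>, which cuts out the same subspace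
  together with \<open>x\<^sub>i\<close>. The definition is for arbitrary commutative rings, to be used for a field and for
  the ring of polynomials in the coefficients.
\<close>

definition genericity :: "nat \<Rightarrow> (nat \<times> nat \<times> nat \<Rightarrow> 'a::comm_ring_1) \<Rightarrow> 'a" where
  "genericity n C = det (row_mat n C 0) *
     (\<Prod>(i, j)\<in>{(i, j) \<in> {..n} \<times> {..n}. i \<noteq> j}. scaled_coeffs n C $$ (i, j)) *
     (\<Prod>(i, j, k, l)\<in>minor_indices n.
        scaled_coeffs n C $$ (i, k) * scaled_coeffs n C $$ (j, l)
        - scaled_coeffs n C $$ (i, l) * scaled_coeffs n C $$ (j, k))"

lemma mult_mat_nth:
  assumes "A \<in> carrier_mat (Suc n) (Suc n)" "B \<in> carrier_mat (Suc n) (Suc n)" "i \<le> n" "j \<le> n"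
  shows "(A * B) $$ (i, j) = (\<Sum>r\<le>n. A $$ (i, r) * B $$ (r, j))"
proof -
  have "(A * B) $$ (i, j) = (\<Sum>r\<in>{0..<Suc n}. row A i $ r * col B j $ r)"
    using assms by (simp add: scalar_prod_def del: sum.op_ivl_Suc)
  also have "\<dots> = (\<Sum>r\<in>{0..<Suc n}. A $$ (i, r) * B $$ (r, j))"
    by (rule sum.cong) (use assms in auto)
  finally show ?thesis by (simp only: atLeast0LessThan lessThan_Suc_atMost)
qed

lemma row_mat_carrier [simp]: "row_mat n C e \<in> carrier_mat (Suc n) (Suc n)"
  by (simp add: row_mat_def)

lemma scaled_coeffs_carrier [simp]: "scaled_coeffs n C \<in> carrier_mat (Suc n) (Suc n)"
  unfolding scaled_coeffs_def
  by (rule mult_carrier_mat[OF row_mat_carrier adj_mat(1)[OF row_mat_carrier]])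

lemma scaled_coeffs_mult:
  "scaled_coeffs n C * row_mat n C 0 = det (row_mat n C 0) \<cdot>\<^sub>m row_mat n C 1"
proof -
  let ?X = "row_mat n C 0" and ?G = "row_mat n C 1"
  have adj: "adj_mat ?X \<in> carrier_mat (Suc n) (Suc n)"
    "adj_mat ?X * ?X = det ?X \<cdot>\<^sub>m 1\<^sub>m (Suc n)"
    using adj_mat[OF row_mat_carrier[of n C 0]] by auto
  have "?G * adj_mat ?X * ?X = ?G * (adj_mat ?X * ?X)"
    by (rule assoc_mult_mat[OF row_mat_carrier adj(1) row_mat_carrier])
  also have "\<dots> = det ?X \<cdot>\<^sub>m ?G"
    unfolding adj(2) unfolding mult_smult_distrib[OF row_mat_carrier one_carrier_mat]
      right_mult_one_mat[OF row_mat_carrier] ..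
  finally show ?thesis by (simp add: scaled_coeffs_def)
qed

lemma scaled_coeffs_eq:
  assumes "\<And>i k. i \<le> n \<Longrightarrow> k \<le> n \<Longrightarrow> C (i, 1, k) = (\<Sum>j\<le>n. a i j * C (j, 0, k))"
    and ij: "i \<le> n" "j \<le> n"
  shows "scaled_coeffs n C $$ (i, j) = det (row_mat n C 0) * a i j"
proof -
  let ?X = "row_mat n C 0" and ?A = "mat (Suc n) (Suc n) (\<lambda>(i, j). a i j)"
  have adj: "adj_mat ?X \<in> carrier_mat (Suc n) (Suc n)"
    "?X * adj_mat ?X = det ?X \<cdot>\<^sub>m 1\<^sub>m (Suc n)"
    using adj_mat[OF row_mat_carrier[of n C 0]] by auto
  have "row_mat n C 1 = ?A * ?X"
    by (rule eq_matI)
      (auto simp: row_mat_def assms(1)[unfolded One_nat_def] scalar_prod_def atLeast0LessThan lessThan_Suc_atMost)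
  then have "scaled_coeffs n C = ?A * (?X * adj_mat ?X)"
    unfolding scaled_coeffs_def using assoc_mult_mat[OF mat_carrier row_mat_carrier adj(1)] by simp
  also have "\<dots> = det ?X \<cdot>\<^sub>m ?A"
    unfolding adj(2) unfolding mult_smult_distrib[OF mat_carrier one_carrier_mat]
      right_mult_one_mat[OF mat_carrier] ..
  finally show ?thesis using ij by simp
qed

lemma genericity_nonzero_iff:
  fixes C :: "nat \<times> nat \<times> nat \<Rightarrow> 'a::field"
  shows "genericity n C \<noteq> 0 \<longleftrightarrow> det (row_mat n C 0) \<noteq> 0 \<and>
    (\<forall>i\<le>n. \<forall>j\<le>n. i \<noteq> j \<longrightarrow> scaled_coeffs n C $$ (i, j) \<noteq> 0) \<and>
    minors_nonzero n (\<lambda>i j. scaled_coeffs n C $$ (i, j))"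
proof -
  let ?c = "\<lambda>i j. scaled_coeffs n C $$ (i, j)"
  have "finite {(i, j) \<in> {..n} \<times> {..n}. i \<noteq> j}"
    by (rule finite_subset[of _ "{..n} \<times> {..n}"]) auto
  then have "(\<Prod>(i, j)\<in>{(i, j) \<in> {..n} \<times> {..n}. i \<noteq> j}. ?c i j) \<noteq> 0 \<longleftrightarrow>
      (\<forall>i\<le>n. \<forall>j\<le>n. i \<noteq> j \<longrightarrow> ?c i j \<noteq> 0)"
    by (subst prod_zero_iff) auto
  moreover have "(\<Prod>(i, j, k, l)\<in>minor_indices n. ?c i k * ?c j l - ?c i l * ?c j k) \<noteq> 0 \<longleftrightarrow>
      (\<forall>(i, j, k, l)\<in>minor_indices n. ?c i k * ?c j l \<noteq> ?c i l * ?c j k)"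
    by (subst prod_zero_iff) auto
  moreover have "\<dots> \<longleftrightarrow> minors_nonzero n ?c"
    unfolding minors_nonzero_def minor_indices_def by fastforce
  ultimately show ?thesis by (simp add: genericity_def)
qed

context comm_ring_hom
begin

lemma hom_adj_mat:
  assumes "A \<in> carrier_mat m m"
  shows "adj_mat (map_mat hom A) = map_mat hom (adj_mat A)"
proof -
  have "mat_delete (map_mat hom A) i j = map_mat hom (mat_delete A i j)" for i j
    by (rule eq_matI) (use assms in \<open>auto simp: mat_delete_def\<close>)
  then have "cofactor (map_mat hom A) i j = hom (cofactor A i j)" for i j
    by (simp add: cofactor_def hom_distribs)
  then show ?thesis by (intro eq_matI) (auto simp: adj_mat_def)
qed

lemma hom_genericity: "hom (genericity n C) = genericity n (\<lambda>v. hom (C v))"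
proof -
  have row: "row_mat n (\<lambda>v. hom (C v)) e = map_mat hom (row_mat n C e)" for e
    by (rule eq_matI) (auto simp: row_mat_def)
  have "scaled_coeffs n (\<lambda>v. hom (C v)) = map_mat hom (scaled_coeffs n C)"
    unfolding scaled_coeffs_def row hom_adj_mat[OF row_mat_carrier]
    by (rule mat_hom_mult[OF row_mat_carrier, symmetric]) (rule adj_mat(1)[OF row_mat_carrier])
  then have "scaled_coeffs n (\<lambda>v. hom (C v)) $$ (i, j) = hom (scaled_coeffs n C $$ (i, j))"
    if "i \<le> n" "j \<le> n" for i j
    using that carrier_matD[OF scaled_coeffs_carrier[of n C]] by simp
  then show ?thesis
    unfolding genericity_def row hom_distribs hom_det
    by (intro arg_cong2[of _ _ _ _ "(*)"] prod.cong refl)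
      (auto simp: minor_indices_def hom_distribs)
qed

end

lemma det_in_poly_ring:
  fixes A :: "('v, 'a::comm_ring_1) mpoly mat"
  assumes A: "A \<in> carrier_mat m m" and el: "\<And>i j. i < m \<Longrightarrow> j < m \<Longrightarrow> A $$ (i, j) \<in> poly_ring V"
  shows "det A \<in> poly_ring V"
  unfolding det_def'[OF A] atLeast0LessThan
proof (rule poly_ring_sum)
  fix \<sigma>
  assume "\<sigma> \<in> {p. p permutes {..<m}}"
  then have "\<sigma> permutes {..<m}" by simp
  then have "(\<Prod>i<m. A $$ (i, \<sigma> i)) \<in> poly_ring V"
    using permutes_in_image[of \<sigma> "{..<m}"] by (intro poly_ring_prod el) auto
  then show "signof \<sigma> * (\<Prod>i<m. A $$ (i, \<sigma> i)) \<in> poly_ring V"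
    by (auto simp: sign_def intro: poly_ring_uminus)
qed

lemma genericity_in_poly_ring:
  fixes C :: "nat \<times> nat \<times> nat \<Rightarrow> ('v, 'a::comm_ring_1) mpoly"
  assumes C: "\<And>i e j. i \<le> n \<Longrightarrow> e \<le> 1 \<Longrightarrow> j \<le> n \<Longrightarrow> C (i, e, j) \<in> poly_ring V"
  shows "genericity n C \<in> poly_ring V"
proof -
  have row: "row_mat n C e $$ (i, j) \<in> poly_ring V" if "i < Suc n" "j < Suc n" "e \<le> 1" for i j e
    using C[of i e j] that by (simp add: row_mat_def)
  have adj: "adj_mat (row_mat n C 0) $$ (i, j) \<in> poly_ring V" if ij: "i < Suc n" "j < Suc n" for i j
  proof -
    have del: "mat_delete (row_mat n C 0) j i \<in> carrier_mat n n"
      using mat_delete_carrier[OF row_mat_carrier[of n C 0]] by simp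
    have "det (mat_delete (row_mat n C 0) j i) \<in> poly_ring V"
      by (rule det_in_poly_ring[OF del]) (auto simp: mat_delete_def row_mat_def intro!: C)
    moreover have "(- 1 :: ('v, 'a) mpoly) ^ k \<in> poly_ring V" for k
      by (induction k) (simp_all add: poly_ring_uminus)
    ultimately show ?thesis
      using ij by (auto simp: adj_mat_def row_mat_def cofactor_def intro!: poly_ring_mult)
  qed
  have coeff: "scaled_coeffs n C $$ (i, j) \<in> poly_ring V" if "i \<le> n" "j \<le> n" for i j
    unfolding scaled_coeffs_def
      mult_mat_nth[OF row_mat_carrier adj_mat(1)[OF row_mat_carrier] that]
    using that by (auto intro!: poly_ring_sum poly_ring_mult row adj)
  show ?thesis
    unfolding genericity_def
    by (intro poly_ring_mult poly_ring_prod det_in_poly_ring[OF row_mat_carrier])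
      (auto simp: minor_indices_def intro!: row coeff poly_ring_mult poly_ring_diff)
qed

section \<open>The open set of general tuples\<close>

lemma indep_family_lin_iff_det:
  "indep_family {..n} (\<lambda>i. lin n (\<lambda>j. C (i, e, j))) \<longleftrightarrow> det (row_mat n C e) \<noteq> 0"
proof
  let ?X = "row_mat n C e"
  let ?XT = "mat (Suc n) (Suc n) (\<lambda>(k, i). C (i, e, k))"
  have T: "transpose_mat ?X = ?XT" by (rule eq_matI) (auto simp: row_mat_def)
  have det: "det ?XT = det ?X" using det_transpose[OF row_mat_carrier[of n C e]] T by simp
  have sum: "(\<Sum>i\<le>n. psmult (v i) (lin n (\<lambda>j. C (i, e, j)))) = lin n (\<lambda>k. \<Sum>i\<le>n. v i * C (i, e, k))"
    for v by (rule lin_sum)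
  show "det ?X \<noteq> 0" if ind: "indep_family {..n} (\<lambda>i. lin n (\<lambda>j. C (i, e, j)))"
  proof
    assume "det ?X = 0"
    then obtain v where v: "v \<in> carrier_vec (Suc n)" "v \<noteq> 0\<^sub>v (Suc n)" "?XT *\<^sub>v v = 0\<^sub>v (Suc n)"
      unfolding det[symmetric] det_0_iff_vec_prod_zero[OF mat_carrier] by blast
    have vv: "v = vec (Suc n) (\<lambda>k. v $ k)" using v(1) by auto
    have "(\<Sum>i\<le>n. v $ i * C (i, e, k)) = 0" if "k \<le> n" for k
    proof -
      have "(?XT *\<^sub>v vec (Suc n) (\<lambda>k. v $ k)) $ k = 0"
        using v(3) vv that by simp
      then show ?thesis using that by (subst (asm) mult_mat_vec_nth) (auto simp: mult.commute)
    qed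
    then have "lin n (\<lambda>k. \<Sum>i\<le>n. v $ i * C (i, e, k)) = 0" by (simp add: lin_def)
    then have "\<forall>i\<in>{..n}. v $ i = 0"
      unfolding sum[symmetric] by (rule ind[unfolded indep_family_def, rule_format, THEN ballI])
    then have "v $ i = 0" if "i \<le> n" for i using that by simp
    then have "v = 0\<^sub>v (Suc n)" using v(1) by (intro eq_vecI) auto
    then show False using v(2) by simp
  qed
  show "indep_family {..n} (\<lambda>i. lin n (\<lambda>j. C (i, e, j)))" if "det ?X \<noteq> 0"
    unfolding indep_family_def
  proof (intro allI impI)
    fix v
    assume "(\<Sum>i\<le>n. psmult (v i) (lin n (\<lambda>j. C (i, e, j)))) = 0"
    then have 0: "(\<Sum>i\<le>n. v i * C (i, e, k)) = 0" if "k \<le> n" for k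
      unfolding sum using lin_eq_zeroD that by blast
    have "(?XT *\<^sub>v vec (Suc n) v) $ k = 0" if "k < Suc n" for k
      using 0[of k] that by (subst mult_mat_vec_nth) (auto simp: mult.commute)
    then have "?XT *\<^sub>v vec (Suc n) v = 0\<^sub>v (Suc n)" by (intro eq_vecI) auto
    then have v0: "vec (Suc n) v = 0\<^sub>v (Suc n)"
      using that unfolding det[symmetric] det_0_iff_vec_prod_zero[OF mat_carrier] using vec_carrier by blast
    have "v i = 0" if "i \<le> n" for i
    proof -
      have "vec (Suc n) v $ i = 0\<^sub>v (Suc n) $ i" by (simp only: v0)
      then show ?thesis using that by simp
    qed
    then show "\<forall>i\<in>{..n}. v i = 0" by simp
  qed
qed

lemma var_basis: "basis_family {..n} var (forms n 1)"
  unfolding basis_family_iff[OF finite_atMost]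
proof
  show "indep_family {..n} var"
    unfolding indep_family_def using lin_eq_zeroD[unfolded lin_def] by blast
  have "F \<in> range (\<lambda>c. \<Sum>i\<le>n. psmult (c i) (var i))" if "F \<in> forms n 1" for F
    by (rule range_eqI) (rule linear_form_eq_lin[OF that, unfolded lin_def])
  moreover have "(\<Sum>i\<le>n. psmult (c i) (var i)) \<in> forms n 1" for c
    using lin_in_forms[of n c] by (simp add: lin_def)
  ultimately show "forms n 1 = range (\<lambda>c. \<Sum>i\<le>n. psmult (c i) (var i))" by blast
qed

lemma coordinates_iff_det:
  "basis_family {..n} (\<lambda>i. lin n (\<lambda>j. C (i, e, j))) (forms n 1) \<longleftrightarrow> det (row_mat n C e) \<noteq> 0"
proof -
  have "basis_family {..n} (\<lambda>i. lin n (\<lambda>j. C (i, e, j))) (forms n 1)"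
    if "indep_family {..n} (\<lambda>i. lin n (\<lambda>j. C (i, e, j)))"
    by (rule basis_familyI_card[OF var_basis finite_atMost that finite_atMost lin_in_forms refl])
  then show ?thesis
    using indep_family_lin_iff_det[of n C e] by (auto simp: basis_family_iff simp del: One_nat_def)
qed

lemma lin_combination:
  "psmult c (lin n A) + psmult d (lin n B) = lin n (\<lambda>j. c * A j + d * B j)"
  by (simp add: lin_def mpoly.scale_sum_right mpoly.scale_left_distrib sum.distrib)

lemma genericity_nonzeroI:
  assumes x: "basis_family {..n} x (forms n 1)"
    and xC: "\<And>i. i \<le> n \<Longrightarrow> x i = lin n (\<lambda>j. C (i, 0, j))"
    and f: "\<And>i. i \<le> n \<Longrightarrow> (\<Sum>j\<le>n. psmult (a i j) (x j)) = lin n (\<lambda>j. C (i, 1, j))"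
    and a: "\<And>i j. i \<le> n \<Longrightarrow> j \<le> n \<Longrightarrow> i \<noteq> j \<Longrightarrow> a i j \<noteq> 0" and minors: "minors_nonzero n a"
  shows "genericity n C \<noteq> 0"
proof -
  have basis: "basis_family {..n} (\<lambda>i. lin n (\<lambda>j. C (i, 0, j))) (forms n 1)"
  proof -
    have "x ` {..n} = (\<lambda>i. lin n (\<lambda>j. C (i, 0, j))) ` {..n}"
      "inj_on x {..n} = inj_on (\<lambda>i. lin n (\<lambda>j. C (i, 0, j))) {..n}"
      using xC by (auto intro!: image_cong inj_on_cong)
    then show ?thesis using x by (simp add: basis_family_def)
  qed
  have det: "det (row_mat n C 0) \<noteq> 0" by (rule coordinates_iff_det[THEN iffD1, OF basis])
  have "C (i, 1, k) = (\<Sum>j\<le>n. a i j * C (j, 0, k))" if "i \<le> n" "k \<le> n" for i k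
  proof -
    have "lin n (\<lambda>k. C (i, 1, k)) = lin n (\<lambda>k. \<Sum>j\<le>n. a i j * C (j, 0, k))"
      unfolding f[OF that(1), symmetric] lin_sum[symmetric] by (rule sum.cong) (simp_all add: xC)
    then have "lin n (\<lambda>k. C (i, 1, k) - (\<Sum>j\<le>n. a i j * C (j, 0, k))) = 0"
      by (simp add: lin_def mpoly.scale_left_diff_distrib sum_subtractf)
    from lin_eq_zeroD[OF this that(2)] show ?thesis by simp
  qed
  note eq = scaled_coeffs_eq[of n C a, OF this]
  have "minors_nonzero n (\<lambda>i j. scaled_coeffs n C $$ (i, j))"
    unfolding minors_nonzero_def
  proof (intro allI impI)
    fix i j k l
    assume ijkl: "i \<le> n" "j \<le> n" "k \<le> n" "l \<le> n" "i \<noteq> j \<and> k \<noteq> l \<and> k \<notin> {i, j} \<and> l \<notin> {i, j}"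
    have "a i k * a j l \<noteq> a i l * a j k" using minors ijkl unfolding minors_nonzero_def by blast
    then have "det (row_mat n C 0) * det (row_mat n C 0) * (a i k * a j l) \<noteq>
      det (row_mat n C 0) * det (row_mat n C 0) * (a i l * a j k)" using det by simp
    then show "scaled_coeffs n C $$ (i, k) * scaled_coeffs n C $$ (j, l) \<noteq>
      scaled_coeffs n C $$ (i, l) * scaled_coeffs n C $$ (j, k)"
      using ijkl by (simp add: eq mult_ac)
  qed
  then show ?thesis
    unfolding genericity_nonzero_iff using det a by (auto simp: eq)
qed

lemma genericity_nonzeroD:
  fixes C :: "nat \<times> nat \<times> nat \<Rightarrow> 'a::field"
  assumes gen: "genericity n C \<noteq> 0" and x: "\<And>i. x i = lin n (\<lambda>j. C (i, 0, j))"
  obtains c where "basis_family {..n} x (forms n 1)"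
    and "\<And>i. i \<le> n \<Longrightarrow> lin n (\<lambda>j. C (i, 1, j)) = (\<Sum>j\<le>n. psmult (c i j) (x j))"
    and "\<And>i j. i \<le> n \<Longrightarrow> j \<le> n \<Longrightarrow> i \<noteq> j \<Longrightarrow> c i j \<noteq> 0" and "minors_nonzero n c"
proof
  let ?D = "det (row_mat n C 0)"
  define c where "c i j = scaled_coeffs n C $$ (i, j) / ?D" for i j
  have D: "?D \<noteq> 0" using gen genericity_nonzero_iff by blast
  show "basis_family {..n} x (forms n 1)"
    unfolding x[abs_def]
    by (rule coordinates_iff_det[THEN iffD2, OF D])
  show "c i j \<noteq> 0" if "i \<le> n" "j \<le> n" "i \<noteq> j" for i j
    using gen that D unfolding genericity_nonzero_iff c_def by simp
  show "minors_nonzero n c"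
    using gen D unfolding genericity_nonzero_iff minors_nonzero_def c_def by simp
  fix i
  assume i: "i \<le> n"
  show "lin n (\<lambda>j. C (i, 1, j)) = (\<Sum>j\<le>n. psmult (c i j) (x j))"
    unfolding x lin_sum
  proof (rule lin_cong)
    fix k
    assume k: "k \<le> n"
    have "(scaled_coeffs n C * row_mat n C 0) $$ (i, k) = ?D * C (i, 1, k)"
      unfolding scaled_coeffs_mult using i k by (simp add: row_mat_def)
    moreover have "(scaled_coeffs n C * row_mat n C 0) $$ (i, k) =
        (\<Sum>j\<le>n. scaled_coeffs n C $$ (i, j) * C (j, 0, k))"
      unfolding mult_mat_nth[OF scaled_coeffs_carrier row_mat_carrier i k]
      using k by (simp add: row_mat_def)
    ultimately show "C (i, 1, k) = (\<Sum>j\<le>n. c i j * C (j, 0, k))"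
      using D by (simp add: c_def field_simps flip: sum_divide_distrib)
  qed
qed

text \<open>Evaluation at the vertices \<open>j\<close> and \<open>i\<close> isolates \<open>q c\<^sub>j\<close> and then \<open>p\<close>.\<close>

lemma (in linear_coordinates) coordinate_pair_independent:
  assumes ij: "i \<le> n" "j \<le> n" "i \<noteq> j" "c j \<noteq> 0"
    and 0: "psmult p (x i) + psmult q (\<Sum>j\<le>n. psmult (c j) (x j)) = 0"
  shows "p = 0 \<and> q = 0"
proof -
  have ev: "p * peval (vertex k) (x i) + q * (\<Sum>j\<le>n. c j * peval (vertex k) (x j)) = 0" for k
    using arg_cong[OF 0, of "peval (vertex k)"]
    unfolding peval.hom_add peval_psmult peval.hom_sum by simp
  have v: "(\<Sum>j\<le>n. c j * peval (vertex k) (x j)) = c k" if "k \<le> n" for k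
    using that by (simp add: dual if_distrib[of "\<lambda>t. _ * t"] cong: if_cong)
  have "q = 0" using ev[of j, unfolded v[OF ij(2)]] ij by (simp add: dual)
  moreover have "p = 0" using ev[of i] ij \<open>q = 0\<close> by (simp add: dual)
  ultimately show ?thesis by simp
qed

text \<open>
  Each pair of forms of a frame is multiplied by a 2 by 2 matrix \<open>g i\<close>. Singular matrices are not
  excluded, since for \<open>n > 0\<close> \<open>genericity\<close> vanishes on their results.
\<close>

definition change_frame :: "(nat \<Rightarrow> nat \<Rightarrow> nat \<Rightarrow> 'a::field) \<Rightarrow>
    (nat \<times> nat \<times> nat \<Rightarrow> 'a) \<Rightarrow> nat \<times> nat \<times> nat \<Rightarrow> 'a" where
  "change_frame g b = (\<lambda>(i, e, j). g i e 0 * b (i, 0, j) + g i e 1 * b (i, 1, j))"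

text \<open>
  Genericity of the changed frame as a polynomial in the entries of the original one.
\<close>

definition genericity_poly ::
    "nat \<Rightarrow> (nat \<Rightarrow> nat \<Rightarrow> nat \<Rightarrow> 'a::field) \<Rightarrow> (nat \<times> nat \<times> nat, 'a) mpoly" where
  "genericity_poly n g = genericity n (\<lambda>(i, e, j).
     psmult (g i e 0) (var (i, 0, j)) + psmult (g i e 1) (var (i, 1, j)))"

lemma peval_genericity_poly:
  "peval b (genericity_poly n g) = genericity n (change_frame g b)"
  unfolding genericity_poly_def change_frame_def peval.hom_genericity
  by (rule arg_cong[of _ _ "genericity n"]) (auto simp: fun_eq_iff peval.hom_add)

lemma genericity_poly_in_poly_ring:
  "genericity_poly n g \<in> poly_ring ({..n} \<times> {..1} \<times> {..n})"
  unfolding genericity_poly_def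
  by (rule genericity_in_poly_ring) (auto intro!: poly_ring_add poly_ring_psmult poly_ring_var)

lemma lin_change_frame:
  "lin n (\<lambda>j. change_frame g b (i, e, j)) =
     psmult (g i e 0) (row_form n b i 0) + psmult (g i e 1) (row_form n b i 1)"
  by (simp add: row_form_eq_lin lin_combination change_frame_def)

text \<open>
  This is defined by tuples, not by frames: adapted coordinates may start from any frame of the tuple.
  Its equations therefore involve the polynomials for all changes of frame.
\<close>

definition general_tuples :: "nat \<Rightarrow> (nat \<Rightarrow> (nat \<Rightarrow> 'a::field_char_0 alg_closure) set) set" where
  "general_tuples n =
     {\<Lambda> \<in> params n. \<exists>x a. adapted_coords n \<Lambda> x a \<and> minors_nonzero n a}"

lemma row_form_in_forms: "row_form n b i e \<in> forms n 1"
  by (simp only: row_form_eq_lin lin_in_forms)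

lemma frame_tuple_in_params: "is_frame n b \<Longrightarrow> frame_tuple n b \<in> params n"
  unfolding params_def frame_tuple_def codim2_subspaces_def is_frame_def
  using row_form_in_forms by (intro restrict_PiE_iff[THEN iffD2] ballI) blast

lemma frame_exists:
  assumes "\<Lambda> \<in> params n"
  obtains b where "is_frame n b" "frame_tuple n b = \<Lambda>"
proof -
  have "\<forall>i. \<exists>l m. i \<le> n \<longrightarrow> \<Lambda> i = zero_locus n {l, m} \<and> l \<in> forms n 1 \<and> m \<in> forms n 1 \<and>
      l \<noteq> m \<and> mpoly.independent {l, m}"
    using assms unfolding params_def codim2_subspaces_def by (fastforce simp: PiE_iff)
  then obtain l m where lm: "\<And>i. i \<le> n \<Longrightarrow> \<Lambda> i = zero_locus n {l i, m i} \<and> l i \<in> forms n 1 \<and>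
      m i \<in> forms n 1 \<and> l i \<noteq> m i \<and> mpoly.independent {l i, m i}"
    by metis
  define b where "b = (\<lambda>(i, e :: nat, j). Poly_Mapping.lookup (if e = 0 then l i else m i)
      (Poly_Mapping.single j 1))"
  have row: "row_form n b i 0 = l i" "row_form n b i 1 = m i" if "i \<le> n" for i
    using linear_form_eq_lin[of "l i" n] linear_form_eq_lin[of "m i" n] lm[OF that]
    by (simp_all add: row_form_eq_lin b_def)
  have "is_frame n b" using lm row by (simp add: is_frame_def)
  moreover have "frame_tuple n b = \<Lambda>"
  proof
    fix i
    show "frame_tuple n b i = \<Lambda> i"
      using lm[of i] row[of i] assms by (cases "i \<le> n") (auto simp: frame_tuple_def params_def PiE_iff extensional_def)
  qed
  ultimately show ?thesis by (rule that)
qed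

text \<open>
  Given adapted coordinates, the forms of the frame lie in the ideals \<open>(x\<^sub>i, f\<^sub>i)\<close>, hence are combinations
  of \<open>x\<^sub>i\<close> and \<open>f\<^sub>i\<close>; being independent, they can be exchanged, so \<open>x\<^sub>i, f\<^sub>i\<close> arise from the frame by some
  \<open>g\<close>. Conversely, if the changed frame \<open>x\<^sub>i, g\<^sub>i\<close> is generic, then \<open>x\<^sub>i\<close> and \<open>f\<^sub>i = g\<^sub>i - c\<^sub>i\<^sub>i x\<^sub>i\<close> are
  independent combinations of the forms of the frame and cut out the same subspace.
\<close>

lemma general_tuples_iff_genericity:
  fixes b :: "nat \<times> nat \<times> nat \<Rightarrow> 'a::field_char_0"
  assumes n: "n \<ge> 2" and b: "is_frame n b"
  shows "frame_tuple n b \<in> general_tuples n \<longleftrightarrow> (\<exists>g. peval b (genericity_poly n g) \<noteq> 0)"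
proof
  let ?r = "row_form n b"
  assume "frame_tuple n b \<in> general_tuples n"
  then obtain x a where ad: "adapted_coords n (frame_tuple n b) x a" and minors: "minors_nonzero n a"
    by (auto simp: general_tuples_def)
  obtain E where "adapted_coordinates n x E a (frame_tuple n b)"
    using adapted_coordinates_exist[OF n frame_tuple_in_params[OF b] ad] .
  then interpret adapted_coordinates n x E a "frame_tuple n b" .
  let ?f = "\<lambda>i. \<Sum>j\<le>n. psmult (a i j) (x j)"
  have f: "?f i \<in> forms n 1" for i by (intro forms_sum forms_psmult x_form) simp
  have "\<exists>h :: nat \<Rightarrow> nat \<Rightarrow> 'a. x i = psmult (h 0 0) (?r i 0) + psmult (h 0 1) (?r i 1) \<and>
      ?f i = psmult (h 1 0) (?r i 0) + psmult (h 1 1) (?r i 1)" if i: "i \<le> n" for i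
  proof -
    have mem: "?r i e \<in> ideal2 n (x i) (?f i)" if "e \<in> {0, 1}" for e
    proof -
      have "?r i e \<in> vanishing_ideal n (frame_tuple n b i)"
        using that i forms_in_poly_ring[OF row_form_in_forms[of n b i e]]
        by (auto simp: vanishing_ideal_def vanishes_on_def frame_tuple_def zero_locus_def)
      then show ?thesis using ad i by (auto simp: adapted_coords_def)
    qed
    have "\<exists>c d. ?r i e = psmult c (x i) + psmult d (?f i)" if "e \<in> {0, 1}" for e
      using linear_form_in_ideal2[OF x_form[OF i] f row_form_in_forms mem[OF that]] by blast
    from this[of 0] this[of 1] obtain p q p' q' where r: "?r i 0 = psmult p (x i) + psmult q (?f i)"
      "?r i 1 = psmult p' (x i) + psmult q' (?f i)" by auto
    have "?r i 0 \<noteq> ?r i 1 \<and> mpoly.independent {?r i 0, ?r i 1}"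
      using b i by (simp add: is_frame_def)
    then have ind: "psmult c (?r i 0) + psmult d (?r i 1) = 0 \<Longrightarrow> c = 0 \<and> d = 0" for c d
      unfolding independent_pair_iff by blast
    obtain c d c' d' where "x i = psmult c (?r i 0) + psmult d (?r i 1)"
      "?f i = psmult c' (?r i 0) + psmult d' (?r i 1)"
      by (rule independent_pair_exchange[OF ind r])
    then show ?thesis
      by (intro exI[of _ "\<lambda>e k. if e = 0 then if k = 0 then c else d else if k = 0 then c' else d'"])
        simp
  qed
  then have "\<forall>i. \<exists>h :: nat \<Rightarrow> nat \<Rightarrow> 'a. i \<le> n \<longrightarrow>
      x i = psmult (h 0 0) (?r i 0) + psmult (h 0 1) (?r i 1) \<and>
      ?f i = psmult (h 1 0) (?r i 0) + psmult (h 1 1) (?r i 1)" by blast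
  from choice[OF this] obtain g :: "nat \<Rightarrow> nat \<Rightarrow> nat \<Rightarrow> 'a" where g: "\<And>i. i \<le> n \<Longrightarrow>
      x i = psmult (g i 0 0) (?r i 0) + psmult (g i 0 1) (?r i 1) \<and>
      ?f i = psmult (g i 1 0) (?r i 0) + psmult (g i 1 1) (?r i 1)" by blast
  have "genericity n (change_frame g b) \<noteq> 0"
  proof (rule genericity_nonzeroI[OF basis])
    show "x i = lin n (\<lambda>j. change_frame g b (i, 0, j))"
      "?f i = lin n (\<lambda>j. change_frame g b (i, 1, j))" if "i \<le> n" for i
      using g[OF that] by (simp_all only: lin_change_frame)
  qed (use a_eq_0_iff minors in auto)
  then show "\<exists>g. peval b (genericity_poly n g) \<noteq> 0" by (auto simp: peval_genericity_poly)
next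
  let ?r = "row_form n b"
  assume "\<exists>g. peval b (genericity_poly n g) \<noteq> 0"
  then obtain g where gen: "genericity n (change_frame g b) \<noteq> 0"
    by (auto simp: peval_genericity_poly)
  define x where "x i = lin n (\<lambda>j. change_frame g b (i, 0, j))" for i
  obtain c where x: "basis_family {..n} x (forms n 1)"
    and h: "\<And>i. i \<le> n \<Longrightarrow> lin n (\<lambda>j. change_frame g b (i, 1, j)) = (\<Sum>j\<le>n. psmult (c i j) (x j))"
    and c: "\<And>i j. i \<le> n \<Longrightarrow> j \<le> n \<Longrightarrow> i \<noteq> j \<Longrightarrow> c i j \<noteq> 0" and minors: "minors_nonzero n c"
    using genericity_nonzeroD[OF gen x_def] by blast
  obtain E where "linear_coordinates n x E" using linear_coordinates_exist[OF x] .
  then interpret linear_coordinates n x E .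
  define a where "a i j = (if i = j then 0 else c i j)" for i j
  let ?f = "\<lambda>i. \<Sum>j\<le>n. psmult (a i j) (x j)"
  have "frame_tuple n b i = zero_locus n {x i, ?f i}" if i: "i \<le> n" for i
  proof -
    have "(\<Sum>j\<le>n. psmult (c i j) (x j)) = (\<Sum>j\<le>n. psmult (a i j) (x j) + (if j = i then psmult (c i i) (x i) else 0))"
      by (rule sum.cong) (auto simp: a_def)
    then have "?f i = lin n (\<lambda>j. change_frame g b (i, 1, j)) - psmult (c i i) (x i)"
      using h[OF i] i by (simp add: sum.distrib)
    then have fi: "?f i = psmult (g i 1 0 - c i i * g i 0 0) (?r i 0) + psmult (g i 1 1 - c i i * g i 0 1) (?r i 1)"
      by (simp add: x_def lin_change_frame mpoly.scale_left_diff_distrib mpoly.scale_right_distrib)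
    have xi: "x i = psmult (g i 0 0) (?r i 0) + psmult (g i 0 1) (?r i 1)"
      by (simp add: x_def lin_change_frame)
    obtain j where j: "j \<le> n" "j \<noteq> i" using n that[of 0] that[of 1] by (cases "i = 0") auto
    have ind: "psmult p (x i) + psmult q (?f i) = 0 \<Longrightarrow> p = 0 \<and> q = 0" for p q
      by (rule coordinate_pair_independent[of i j "a i"]) (use i j c in \<open>auto simp: a_def\<close>)
    obtain p q p' q' where r: "?r i 0 = psmult p (x i) + psmult q (?f i)"
      "?r i 1 = psmult p' (x i) + psmult q' (?f i)"
      by (rule independent_pair_exchange[OF ind xi fi])
    have "geval y (?r i 0) = 0 \<and> geval y (?r i 1) = 0 \<longleftrightarrow> geval y (x i) = 0 \<and> geval y (?f i) = 0" for y
    proof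
      assume "geval y (?r i 0) = 0 \<and> geval y (?r i 1) = 0"
      then show "geval y (x i) = 0 \<and> geval y (?f i) = 0"
        using arg_cong[OF xi, of "geval y"] arg_cong[OF fi, of "geval y"]
        unfolding geval.hom_add geval_psmult by simp
    next
      assume "geval y (x i) = 0 \<and> geval y (?f i) = 0"
      then show "geval y (?r i 0) = 0 \<and> geval y (?r i 1) = 0"
        using arg_cong[OF r(1), of "geval y"] arg_cong[OF r(2), of "geval y"]
        unfolding geval.hom_add geval_psmult by simp
    qed
    then show ?thesis using i by (auto simp: frame_tuple_def zero_locus_def)
  qed
  then have "adapted_coordinates n x E a (frame_tuple n b)"
    using n c by unfold_locales (auto simp: a_def)
  then have "adapted_coords n (frame_tuple n b) x a" by (rule adapted_coordinates.adapted)
  moreover have "minors_nonzero n a" using minors by (auto simp: minors_nonzero_def a_def)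
  ultimately show "frame_tuple n b \<in> general_tuples n"
    using frame_tuple_in_params[OF b] by (auto simp: general_tuples_def)
qed

lemma general_tuples_open:
  assumes "n \<ge> 2"
  shows "zariski_open n (general_tuples n)"
  unfolding zariski_open_def
proof (intro conjI exI[of _ "range (genericity_poly n)"])
  show "general_tuples n \<subseteq> params n" by (auto simp: general_tuples_def)
qed (use genericity_poly_in_poly_ring general_tuples_iff_genericity[OF assms] in auto)

text \<open>
  A nonempty open set contains the tuple of a frame at which one of its polynomials \<open>p\<close> is nonzero. It
  suffices to find an array at which both \<open>p\<close> and the genericity polynomial without change of frame are
  nonzero, since generic arrays are frames. The genericity polynomial is not zero: for the
  coefficients \<open>1 + i j\<close> the minors are \<open>(i - j) (k - l)\<close>, and the coefficients and these minors are
  nonzero in characteristic 0.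
\<close>

lemma general_tuples_dense:
  assumes n: "n \<ge> 2"
  shows "zariski_dense n (general_tuples n :: (nat \<Rightarrow> (nat \<Rightarrow> 'a::field_char_0 alg_closure) set) set)"
  unfolding zariski_dense_def
proof (intro allI impI)
  fix W :: "(nat \<Rightarrow> (nat \<Rightarrow> 'a alg_closure) set) set"
  assume W: "zariski_open n W \<and> W \<noteq> {}"
  then obtain S where S: "\<And>b :: nat \<times> nat \<times> nat \<Rightarrow> 'a. is_frame n b \<Longrightarrow>
      frame_tuple n b \<in> W \<longleftrightarrow> (\<exists>p\<in>S. peval b p \<noteq> 0)" and "W \<subseteq> params n"
    unfolding zariski_open_def by blast
  then obtain b0 :: "nat \<times> nat \<times> nat \<Rightarrow> 'a" where "is_frame n b0" "frame_tuple n b0 \<in> W"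
    using W frame_exists by (metis all_not_in_conv subsetD)
  then obtain p where p: "p \<in> S" "peval b0 p \<noteq> 0" using S by blast
  define g :: "nat \<Rightarrow> nat \<Rightarrow> nat \<Rightarrow> 'a" where "g i e k = (if e = k then 1 else 0)" for i e k
  have change: "change_frame g b (i, 0, j) = b (i, 0, j)" "change_frame g b (i, 1, j) = b (i, 1, j)"
    for b :: "nat \<times> nat \<times> nat \<Rightarrow> 'a" and i j
    by (simp_all add: change_frame_def g_def)
  define b1 :: "nat \<times> nat \<times> nat \<Rightarrow> 'a" where "b1 = (\<lambda>(i, e, j).
     if e = 0 then if j = i then 1 else 0 else 1 + of_nat i * of_nat j)"
  have "genericity n (change_frame g b1) \<noteq> 0"
  proof (rule genericity_nonzeroI[OF var_basis, where a = "\<lambda>i j. 1 + of_nat i * of_nat j"])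
    show "var i = lin n (\<lambda>j. change_frame g b1 (i, 0, j))" if "i \<le> n" for i
      unfolding change using that
      by (simp add: b1_def lin_def if_distrib[of "\<lambda>c. psmult c _"] cong: if_cong)
    show "(\<Sum>j\<le>n. psmult (1 + of_nat i * of_nat j) (var j)) = lin n (\<lambda>j. change_frame g b1 (i, 1, j))" for i
      unfolding change by (simp add: b1_def lin_def)
    have "(1 :: 'a) + of_nat i * of_nat j = of_nat (Suc (i * j))" for i j by simp
    then show "(1 :: 'a) + of_nat i * of_nat j \<noteq> 0" for i j
      by (metis of_nat_neq_0)
    show "minors_nonzero n (\<lambda>i j. (1 :: 'a) + of_nat i * of_nat j)"
      unfolding minors_nonzero_def
    proof (intro allI impI notI)
      fix i j k l :: nat
      assume ne: "i \<noteq> j \<and> k \<noteq> l \<and> k \<notin> {i, j} \<and> l \<notin> {i, j}"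
        and "((1 :: 'a) + of_nat i * of_nat k) * (1 + of_nat j * of_nat l) =
          (1 + of_nat i * of_nat l) * (1 + of_nat j * of_nat k)"
      then have "((of_nat i :: 'a) - of_nat j) * (of_nat k - of_nat l) = 0"
        by (simp add: algebra_simps)
      then show False using ne by simp
    qed
  qed
  then have "peval b1 (genericity_poly n g) \<noteq> 0" by (simp add: peval_genericity_poly)
  moreover note p(2)
  ultimately have "\<exists>b. peval b f \<noteq> 0" if "f \<in> {p, genericity_poly n g}" for f
    using that by blast
  then obtain b where b: "\<And>f. f \<in> {p, genericity_poly n g} \<Longrightarrow> peval b f \<noteq> 0"
    by (rule line_poly_common_nonzero[of "{p, genericity_poly n g}" "\<lambda>f b. peval b f", rotated 2])
      (auto intro: line_poly_peval)
  have gen: "genericity n (change_frame g b) \<noteq> 0"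
    using b[of "genericity_poly n g"] by (simp add: peval_genericity_poly)
  have frame: "is_frame n b"
    unfolding is_frame_def independent_pair_iff
  proof (intro allI impI)
    fix i q q'
    assume i: "i \<le> n" and 0: "psmult q (row_form n b i 0) + psmult q' (row_form n b i 1) = 0"
    define x where "x i = lin n (\<lambda>j. change_frame g b (i, 0, j))" for i
    obtain c where x: "basis_family {..n} x (forms n 1)"
      and h: "\<And>i. i \<le> n \<Longrightarrow> lin n (\<lambda>j. change_frame g b (i, 1, j)) = (\<Sum>j\<le>n. psmult (c i j) (x j))"
      and c: "\<And>i j. i \<le> n \<Longrightarrow> j \<le> n \<Longrightarrow> i \<noteq> j \<Longrightarrow> c i j \<noteq> 0"
      and "minors_nonzero n c"
      using genericity_nonzeroD[OF gen x_def] by blast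
    obtain E where "linear_coordinates n x E" using linear_coordinates_exist[OF x] .
    then interpret linear_coordinates n x E .
    obtain j where j: "j \<le> n" "j \<noteq> i" using n that[of 0] that[of 1] by (cases "i = 0") auto
    show "q = 0 \<and> q' = 0"
    proof (rule coordinate_pair_independent[of i j "c i"])
      show "psmult q (x i) + psmult q' (\<Sum>j\<le>n. psmult (c i j) (x j)) = 0"
        unfolding h[OF i, symmetric] using 0 by (simp only: x_def change row_form_eq_lin)
    qed (use i j c in auto)
  qed
  have "frame_tuple n b \<in> W" using S[OF frame] p(1) b by blast
  moreover have "frame_tuple n b \<in> general_tuples n"
    using general_tuples_iff_genericity[OF n frame] b by blast
  ultimately show "general_tuples n \<inter> W \<noteq> {}" by blast
qed

theorem proposition3p1:
  fixes n :: nat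
  assumes "n \<ge> 2"
  shows "for_general n (\<lambda>\<Lambda> :: nat \<Rightarrow> (nat \<Rightarrow> 'a::field_char_0 alg_closure) set.
    (\<exists>x a. adapted_coords n \<Lambda> x a) \<and>
    (\<forall>j\<le>n. \<exists>!H. H \<in> hypersurface ` Q_forms n \<Lambda> j) \<and>
    (\<forall>x a Q. adapted_coords n \<Lambda> x a \<and> (\<forall>j\<le>n. Q j \<in> Q_forms n \<Lambda> j) \<longrightarrow>
       basis_family {..n} (\<lambda>i. x i * Q i) (lin_system n \<Lambda>)) \<and>
    mpoly.dim (lin_system n \<Lambda>) = n + 1 \<and>
    (\<forall>N s. N + 1 = mpoly.dim (lin_system n \<Lambda>) \<and> basis_family {..N} s (lin_system n \<Lambda>) \<longrightarrow>
       N = n \<and> is_rational_map n N s \<and>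
       (\<forall>H\<in>hyperplanes N. \<not> rational_image n N s \<subseteq> H)))"
  unfolding for_general_def
proof (intro exI[of _ "general_tuples n"] conjI ballI)
  show "zariski_open n (general_tuples n :: (nat \<Rightarrow> (nat \<Rightarrow> 'a alg_closure) set) set)"
    by (rule general_tuples_open[OF assms])
  show "zariski_dense n (general_tuples n :: (nat \<Rightarrow> (nat \<Rightarrow> 'a alg_closure) set) set)"
    by (rule general_tuples_dense[OF assms])
  fix \<Lambda> :: "nat \<Rightarrow> (nat \<Rightarrow> 'a alg_closure) set"
  assume "\<Lambda> \<in> general_tuples n"
  then obtain x a where \<Lambda>: "\<Lambda> \<in> params n" and ad: "adapted_coords n \<Lambda> x a"
    and minors: "minors_nonzero n a" by (auto simp: general_tuples_def)
  obtain E where "adapted_coordinates n x E a \<Lambda>"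
    using adapted_coordinates_exist[OF assms \<Lambda> ad] .
  then interpret adapted_coordinates n x E a \<Lambda> .
  interpret general_coordinates n x E a \<Lambda>
    by unfold_locales (rule minors)
  show "\<exists>x a. adapted_coords n \<Lambda> x a" using ad by blast
  show "\<forall>j\<le>n. \<exists>!H. H \<in> hypersurface ` Q_forms n \<Lambda> j" using hypersurface_unique by blast
  show "\<forall>x a Q. adapted_coords n \<Lambda> x a \<and> (\<forall>j\<le>n. Q j \<in> Q_forms n \<Lambda> j) \<longrightarrow>
       basis_family {..n} (\<lambda>i. x i * Q i) (lin_system n \<Lambda>)"
  proof (intro allI impI)
    fix x' a' Q
    assume *: "adapted_coords n \<Lambda> x' a' \<and> (\<forall>j\<le>n. Q j \<in> Q_forms n \<Lambda> j)"
    then obtain E' where "adapted_coordinates n x' E' a' \<Lambda>"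
      using adapted_coordinates_exist[OF assms \<Lambda>] by blast
    then show "basis_family {..n} (\<lambda>i. x' i * Q i) (lin_system n \<Lambda>)"
      by (rule products_basis_any_coordinates) (use * in simp)
  qed
  show "mpoly.dim (lin_system n \<Lambda>) = n + 1" by (rule dim_lin_system)
  show "\<forall>N s. N + 1 = mpoly.dim (lin_system n \<Lambda>) \<and> basis_family {..N} s (lin_system n \<Lambda>) \<longrightarrow>
       N = n \<and> is_rational_map n N s \<and> (\<forall>H\<in>hyperplanes N. \<not> rational_image n N s \<subseteq> H)"
  proof (intro allI impI)
    fix N s
    assume *: "N + 1 = mpoly.dim (lin_system n \<Lambda>) \<and> basis_family {..N} s (lin_system n \<Lambda>)"
    then have N: "N = n" by (simp add: dim_lin_system)
    have s: "basis_family {..n} s (lin_system n \<Lambda>)" using * N by simp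
    have "s i \<in> forms n n" if "i \<le> n" for i
      using s that mpoly.span_base[of "s i" "s ` {..n}"] by (auto simp: basis_family_def lin_system_def)
    moreover have "s 0 \<noteq> 0"
      using s mpoly.dependent_zero[of "s ` {..n}"] by (force simp: basis_family_def)
    ultimately have "is_rational_map n n s" by (auto simp: is_rational_map_def)
    then show "N = n \<and> is_rational_map n N s \<and> (\<forall>H\<in>hyperplanes N. \<not> rational_image n N s \<subseteq> H)"
      using image_not_in_hyperplane[OF s] N by simp
  qed
qed

end
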